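(* Let $L$ be a finitely presented linear order. Then $L$ is bounded and discrete if and only if there is an alternating 3-signed tree $(T,s_T)$ with $\mathrm{LIN}(T,s_T)\cong L$.
   Context: Trees: a tree is a nonempty finite set $T\subseteq\omega^{<\omega}$ closed under initial segments, root $\emptyset$, $\sigma*x$ is $\sigma$ extended by $x$; in standard labelling, with $w(T;\sigma)$ the number of children of $\sigma$, $\sigma*x\in T$ iff $x<w(T;\sigma)$. A 3-signed tree (3ST) is $(T,s_T)$ with $s_T:T\to\{+,-,0\}$ and $s_T(\sigma)=0$ iff $\sigma$ is the root or a leaf. A 3ST is alternating if for each non-leaf $\sigma\in T$ exactly one holds: (a) $s_T(\sigma*x)=0$ for all $x<w(T;\sigma)$; (b) $w(T;\sigma)$ is even and $s_T(\sigma*x)=(-1)^x$ ($+$ for even $x$, $-$ for odd $x$) for all $x<w(T;\sigma)$. $A\times B:=\sum_{a\in A}B$ (lexicographic, first coordinate dominant); $\omega^+:=\omega$, $\omega^-:=\omega^*$, $\omega^0:=\mathbf 1$. LIN: if $|T|=1$, $\mathrm{LIN}(T,s_T):=\mathbf 0$; otherwise $\mathrm{LIN}(T,s_T,\sigma):=\omega^{s_T(\sigma)}\times\sum_{x<w(T;\sigma)}\mathrm{LIN}(T,s_T,\sigma*x)$ (empty sum $=\mathbf 1$), $\mathrm{LIN}(T,s_T):=\mathrm{LIN}(T,s_T,\emptyset)$. The class of finitely presented linear orders is the smallest class of linear orders closed under isomorphism, containing $\mathbf 0$ and $\mathbf 1$, closed under finite sums $L_1+L_2$, and closed under $L\mapsto\omega\times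 L$ and $L\mapsto\omega^*\times L$. Discrete: every non-maximum element has an immediate successor and every non-minimum element an immediate predecessor; bounded: has a minimum and a maximum.
   Formalization: The empty order 0 is counted as bounded: it equals LIN of the one-node alternating tree but has no minimum or maximum, so the literal equivalence fails for L = 0; for nonempty L the statement is unchanged. *)

theory Defs
  imports Main "HOL-Library.Sublist"
begin

section \<open>Linear orders and their arithmetic\<close>

text \<open>
  As in \<^theory>\<open>HOL.Order_Relation\<close>, a linear order is a reflexive relation \<open>r\<close> with
  \<^term>\<open>Linear_order r\<close>; its domain is \<^term>\<open>Field r\<close>, and \<open>(x, y) \<in> r\<close> means \<open>x \<le> y\<close>.
  The order \<open>\<zero>\<close> is the empty relation and \<open>\<one>\<close> is any \<open>{(a, a)}\<close>.
\<close>

definition lo_iso :: "'a rel \<Rightarrow> 'b rel \<Rightarrow> bool" (infix "\<cong>\<^sub>l" 50) where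
  "r \<cong>\<^sub>l r' \<longleftrightarrow>
     (\<exists>f. bij_betw f (Field r) (Field r') \<and>
          (\<forall>x\<in>Field r. \<forall>y\<in>Field r. (x, y) \<in> r \<longleftrightarrow> (f x, f y) \<in> r'))"

definition lo_plus :: "'a rel \<Rightarrow> 'b rel \<Rightarrow> ('a + 'b) rel" where
  "lo_plus r s =
     {(Inl a, Inl a') | a a'. (a, a') \<in> r} \<union>
     {(Inr b, Inr b') | b b'. (b, b') \<in> s} \<union>
     {(Inl a, Inr b) | a b. a \<in> Field r \<and> b \<in> Field s}"

definition lo_sum :: "'a rel \<Rightarrow> ('a \<Rightarrow> 'b rel) \<Rightarrow> ('a \<times> 'b) rel" where
  "lo_sum A B =
     {((a, b), (a', b')). a \<in> Field A \<and> a' \<in> Field A \<and> b \<in> Field (B a) \<and> b' \<in> Field (B a') \<and>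
        (a \<noteq> a' \<and> (a, a') \<in> A \<or> a = a' \<and> (b, b') \<in> B a)}"

definition lo_prod :: "'a rel \<Rightarrow> 'b rel \<Rightarrow> ('a \<times> 'b) rel" where
  "lo_prod A B = lo_sum A (\<lambda>_. B)"

definition lo_min :: "'a rel \<Rightarrow> 'a \<Rightarrow> bool" where
  "lo_min r m \<longleftrightarrow> m \<in> Field r \<and> (\<forall>x\<in>Field r. (m, x) \<in> r)"

definition lo_max :: "'a rel \<Rightarrow> 'a \<Rightarrow> bool" where
  "lo_max r m \<longleftrightarrow> m \<in> Field r \<and> (\<forall>x\<in>Field r. (x, m) \<in> r)"

text \<open>
  Pitfall: the empty order is not \<open>lo_bounded\<close>.  It is nevertheless the order of the one-node
  signed tree, so the characterisation of bounded discrete orders has to count it as bounded.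
\<close>

definition lo_bounded :: "'a rel \<Rightarrow> bool" where
  "lo_bounded r \<longleftrightarrow> (\<exists>m. lo_min r m) \<and> (\<exists>m. lo_max r m)"

definition lo_covers :: "'a rel \<Rightarrow> 'a \<Rightarrow> 'a \<Rightarrow> bool" where
  "lo_covers r x y \<longleftrightarrow>
     (x, y) \<in> r \<and> x \<noteq> y \<and> \<not> (\<exists>z. (x, z) \<in> r \<and> (z, y) \<in> r \<and> z \<noteq> x \<and> z \<noteq> y)"

definition lo_discrete :: "'a rel \<Rightarrow> bool" where
  "lo_discrete r \<longleftrightarrow>
     (\<forall>x\<in>Field r. \<not> lo_max r x \<longrightarrow> (\<exists>y. lo_covers r x y)) \<and>
     (\<forall>x\<in>Field r. \<not> lo_min r x \<longrightarrow> (\<exists>y. lo_covers r y x))"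

section \<open>Finitely presented linear orders\<close>

text \<open>
  Here all orders live on one carrier type \<open>'a\<close>, and sums and products, whose natural carrier is a
  different type, are taken up to isomorphism.  This does not depend on the choice of \<open>'a\<close>: the
  summands and factors of an order on \<open>'a\<close> embed into it, hence can be realised on \<open>'a\<close>.
  The lemmas below give linearity and all closure properties across types.
\<close>

inductive finitely_presented :: "'a rel \<Rightarrow> bool" where
  fp_iso: "finitely_presented r \<Longrightarrow> r \<cong>\<^sub>l t \<Longrightarrow> finitely_presented t"
| fp_zero: "finitely_presented {}"
| fp_one: "finitely_presented {(a, a)}"
| fp_plus: "finitely_presented r \<Longrightarrow> finitely_presented s \<Longrightarrow> lo_plus r s \<cong>\<^sub>l t
    \<Longrightarrow> finitely_presented t"
| fp_omega: "finitely_presented r \<Longrightarrow> lo_prod natLeq r \<cong>\<^sub>l t \<Longrightarrow> finitely_presented t"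
| fp_omega_star: "finitely_presented r \<Longrightarrow> lo_prod (natLeq\<inverse>) r \<cong>\<^sub>l t \<Longrightarrow> finitely_presented t"

lemma lo_iso_refl: "r \<cong>\<^sub>l r"
  unfolding lo_iso_def by (intro exI[of _ id]) auto

lemma lo_iso_sym:
  assumes "r \<cong>\<^sub>l s" shows "s \<cong>\<^sub>l r"
proof -
  obtain f where f: "bij_betw f (Field r) (Field s)"
    "\<And>x y. x \<in> Field r \<Longrightarrow> y \<in> Field r \<Longrightarrow> (x, y) \<in> r \<longleftrightarrow> (f x, f y) \<in> s"
    using assms unfolding lo_iso_def by blast
  let ?g = "inv_into (Field r) f"
  have g: "?g x \<in> Field r \<and> f (?g x) = x" if "x \<in> Field s" for x
    using f(1) that by (metis bij_betw_def f_inv_into_f inv_into_into)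
  show ?thesis unfolding lo_iso_def
    by (intro exI[of _ ?g] conjI bij_betw_inv_into f(1) ballI) (simp add: f(2) g)
qed

lemma lo_iso_trans:
  assumes "r \<cong>\<^sub>l s" "s \<cong>\<^sub>l t" shows "r \<cong>\<^sub>l t"
proof -
  obtain f where f: "bij_betw f (Field r) (Field s)"
    "\<And>x y. x \<in> Field r \<Longrightarrow> y \<in> Field r \<Longrightarrow> (x, y) \<in> r \<longleftrightarrow> (f x, f y) \<in> s"
    using assms(1) unfolding lo_iso_def by blast
  obtain g where g: "bij_betw g (Field s) (Field t)"
    "\<And>x y. x \<in> Field s \<Longrightarrow> y \<in> Field s \<Longrightarrow> (x, y) \<in> s \<longleftrightarrow> (g x, g y) \<in> t"
    using assms(2) unfolding lo_iso_def by blast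
  have "f x \<in> Field s" if "x \<in> Field r" for x
    using f(1) that by (auto simp: bij_betw_def)
  then show ?thesis unfolding lo_iso_def
    by (intro exI[of _ "g \<circ> f"] conjI bij_betw_trans[OF f(1) g(1)]) (simp add: f(2) g(2))
qed

lemma lo_iso_image:
  assumes "inj_on f (Field r)" shows "r \<cong>\<^sub>l map_prod f f ` r"
proof -
  have F: "Field (map_prod f f ` r) = f ` Field r" by (force simp: Field_def)
  have "(x, y) \<in> r \<longleftrightarrow> (f x, f y) \<in> map_prod f f ` r" if "x \<in> Field r" "y \<in> Field r" for x y
  proof
    assume "(f x, f y) \<in> map_prod f f ` r"
    then obtain a b where ab: "(a, b) \<in> r" "f x = f a" "f y = f b" by auto
    then have "a \<in> Field r" "b \<in> Field r" by (auto simp: Field_def)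
    then show "(x, y) \<in> r" using ab assms that by (metis inj_onD)
  qed force
  then show ?thesis unfolding lo_iso_def F using assms by (auto simp: bij_betw_def)
qed

lemma Linear_order_iff:
  "Linear_order r \<longleftrightarrow> refl_on (Field r) r \<and> trans r \<and> antisym r \<and> total_on (Field r) r"
proof -
  have "r \<subseteq> Field r \<times> Field r" by (auto intro: FieldI1 FieldI2)
  then show ?thesis unfolding order_on_defs by blast
qed

lemma lo_iso_Linear_order:
  assumes "Linear_order r" "r \<cong>\<^sub>l t" shows "Linear_order t"
proof -
  obtain f where f: "bij_betw f (Field t) (Field r)"
    "\<And>x y. x \<in> Field t \<Longrightarrow> y \<in> Field t \<Longrightarrow> (x, y) \<in> t \<longleftrightarrow> (f x, f y) \<in> r"
    using lo_iso_sym[OF assms(2)] unfolding lo_iso_def by blast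
  have fF: "f x \<in> Field r" if "x \<in> Field t" for x
    using f(1) that by (auto simp: bij_betw_def)
  have inj: "f x = f y \<Longrightarrow> x = y" if "x \<in> Field t" "y \<in> Field t" for x y
    using f(1) that by (auto simp: bij_betw_def inj_on_def)
  have tF: "x \<in> Field t \<and> y \<in> Field t" if "(x, y) \<in> t" for x y
    using that by (auto intro: FieldI1 FieldI2)
  have lin: "refl_on (Field r) r" "trans r" "antisym r" "total_on (Field r) r"
    using assms(1) unfolding Linear_order_iff by auto
  have "refl_on (Field t) t"
  proof (rule refl_onI)
    fix x assume "x \<in> Field t"
    then show "(x, x) \<in> t" using f(2) fF refl_onD[OF lin(1), of "f x"] by simp
  qed
  moreover have "trans t"
  proof (rule transI)
    fix x y z assume "(x, y) \<in> t" "(y, z) \<in> t"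
    moreover from this have "x \<in> Field t" "y \<in> Field t" "z \<in> Field t" using tF by auto
    ultimately show "(x, z) \<in> t" using f(2) transD[OF lin(2), of "f x" "f y" "f z"] by simp
  qed
  moreover have "antisym t"
  proof (rule antisymI)
    fix x y assume "(x, y) \<in> t" "(y, x) \<in> t"
    moreover from this have "x \<in> Field t" "y \<in> Field t" using tF by auto
    ultimately show "x = y" using f(2) inj antisymD[OF lin(3), of "f x" "f y"] by simp
  qed
  moreover have "total_on (Field t) t"
  proof (rule total_onI)
    fix x y assume xy: "x \<in> Field t" "y \<in> Field t" "x \<noteq> y"
    then have "f x \<noteq> f y" using inj[of x y] by auto
    then have "(f x, f y) \<in> r \<or> (f y, f x) \<in> r"
      using lin(4) fF xy by (auto simp: total_on_def)
    then show "(x, y) \<in> t \<or> (y, x) \<in> t" using f(2) xy by simp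
  qed
  ultimately show ?thesis unfolding Linear_order_iff by blast
qed

lemma Field_lo_plus: "Field (lo_plus r s) = Inl ` Field r \<union> Inr ` Field s"
  unfolding lo_plus_def Field_def by force

lemma Field_lo_sum:
  assumes "\<And>a. a \<in> Field A \<Longrightarrow> refl_on (Field (B a)) (B a)"
  shows "Field (lo_sum A B) = (SIGMA a:Field A. Field (B a))"
proof
  show "Field (lo_sum A B) \<subseteq> (SIGMA a:Field A. Field (B a))"
    unfolding lo_sum_def by (auto simp: Field_def)
  show "(SIGMA a:Field A. Field (B a)) \<subseteq> Field (lo_sum A B)"
  proof clarify
    fix a b assume "a \<in> Field A" "b \<in> Field (B a)"
    then have "((a, b), (a, b)) \<in> lo_sum A B"
      using assms unfolding lo_sum_def refl_on_def by auto
    then show "(a, b) \<in> Field (lo_sum A B)" by (rule FieldI1)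
  qed
qed

lemma Linear_order_lo_plus:
  assumes "Linear_order r" "Linear_order s" shows "Linear_order (lo_plus r s)"
proof -
  have r: "refl_on (Field r) r" "trans r" "antisym r" "total_on (Field r) r"
    using assms(1) unfolding Linear_order_iff by auto
  have s: "refl_on (Field s) s" "trans s" "antisym s" "total_on (Field s) s"
    using assms(2) unfolding Linear_order_iff by auto
  have "refl_on (Field (lo_plus r s)) (lo_plus r s)"
    unfolding Field_lo_plus
    by (rule refl_onI) (use r(1) s(1) in \<open>auto simp: lo_plus_def dest: refl_onD\<close>)
  moreover have "trans (lo_plus r s)"
    by (rule transI)
       (use r(2) s(2) in \<open>auto simp: lo_plus_def intro: FieldI1 FieldI2 dest: transD\<close>)
  moreover have "antisym (lo_plus r s)"
    by (rule antisymI) (use r(3) s(3) in \<open>auto simp: lo_plus_def dest: antisymD\<close>)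
  moreover have "total_on (Field (lo_plus r s)) (lo_plus r s)"
    unfolding Field_lo_plus
    using r(4) s(4) unfolding total_on_def by (simp add: lo_plus_def ball_Un)
  ultimately show ?thesis unfolding Linear_order_iff by blast
qed

lemma Linear_order_lo_sum:
  assumes A: "Linear_order A" and B: "\<And>a. a \<in> Field A \<Longrightarrow> Linear_order (B a)"
  shows "Linear_order (lo_sum A B)"
proof -
  have F: "Field (lo_sum A B) = (SIGMA a:Field A. Field (B a))"
    by (rule Field_lo_sum) (use B in \<open>auto simp: Linear_order_iff\<close>)
  have "refl_on (Field (lo_sum A B)) (lo_sum A B)"
    unfolding F
    by (rule refl_onI) (use B in \<open>auto simp: lo_sum_def Linear_order_iff dest: refl_onD\<close>)
  moreover have "trans (lo_sum A B)"
  proof (rule transI)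
    fix x y z assume *: "(x, y) \<in> lo_sum A B" "(y, z) \<in> lo_sum A B"
    obtain a b a' b' a'' b'' where "x = (a, b)" "y = (a', b')" "z = (a'', b'')"
      by (metis surj_pair)
    moreover have "antisym A" "trans A" using A by (auto simp: Linear_order_iff)
    moreover have "trans (B a)" if "a \<in> Field A" using B[OF that] by (auto simp: Linear_order_iff)
    ultimately show "(x, z) \<in> lo_sum A B"
      using * unfolding lo_sum_def by (auto dest: transD antisymD)
  qed
  moreover have "antisym (lo_sum A B)"
  proof (rule antisymI)
    fix x y assume *: "(x, y) \<in> lo_sum A B" "(y, x) \<in> lo_sum A B"
    obtain a b a' b' where "x = (a, b)" "y = (a', b')" by (metis surj_pair)
    moreover have "antisym A" using A by (auto simp: Linear_order_iff)
    moreover have "antisym (B a)" if "a \<in> Field A" using B[OF that] by (auto simp: Linear_order_iff)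
    ultimately show "x = y"
      using * unfolding lo_sum_def by (auto dest: antisymD)
  qed
  moreover have "total_on (Field (lo_sum A B)) (lo_sum A B)"
    unfolding F total_on_def
  proof (intro ballI impI)
    fix x y assume *: "x \<in> (SIGMA a:Field A. Field (B a))" "y \<in> (SIGMA a:Field A. Field (B a))" "x \<noteq> y"
    obtain a b a' b' where "x = (a, b)" "y = (a', b')" by (metis surj_pair)
    moreover have "total_on (Field A) A" using A by (auto simp: Linear_order_iff)
    moreover have "total_on (Field (B a)) (B a)" if "a \<in> Field A"
      using B[OF that] by (auto simp: Linear_order_iff)
    ultimately show "(x, y) \<in> lo_sum A B \<or> (y, x) \<in> lo_sum A B"
      using * unfolding lo_sum_def total_on_def by (cases "a = a'") auto
  qed
  ultimately show ?thesis unfolding Linear_order_iff by blast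
qed

lemma Linear_order_natLeq: "Linear_order natLeq" "Linear_order (natLeq\<inverse>)"
  using natLeq_Linear_order by (auto simp: Field_natLeq)

lemma finitely_presented_Linear_order: "finitely_presented r \<Longrightarrow> Linear_order r"
proof (induction rule: finitely_presented.induct)
  case (fp_one a)
  then show ?case
    by (auto simp: Linear_order_iff refl_on_def trans_def antisym_def total_on_def Field_def)
next
  case (fp_plus r s t)
  then show ?case by (blast intro: lo_iso_Linear_order Linear_order_lo_plus)
next
  case (fp_omega r t)
  then have "Linear_order (lo_prod natLeq r)"
    unfolding lo_prod_def by (intro Linear_order_lo_sum Linear_order_natLeq)
  then show ?case using fp_omega by (blast intro: lo_iso_Linear_order)
next
  case (fp_omega_star r t)
  then have "Linear_order (lo_prod (natLeq\<inverse>) r)"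
    unfolding lo_prod_def by (intro Linear_order_lo_sum Linear_order_natLeq)
  then show ?case using fp_omega_star by (blast intro: lo_iso_Linear_order)
qed (auto intro: lo_iso_Linear_order)

lemma lo_plus_cong:
  assumes "r \<cong>\<^sub>l r'" "s \<cong>\<^sub>l s'" shows "lo_plus r s \<cong>\<^sub>l lo_plus r' s'"
proof -
  obtain f where f: "bij_betw f (Field r) (Field r')"
    "\<And>x y. x \<in> Field r \<Longrightarrow> y \<in> Field r \<Longrightarrow> (x, y) \<in> r \<longleftrightarrow> (f x, f y) \<in> r'"
    using assms(1) unfolding lo_iso_def by blast
  obtain g where g: "bij_betw g (Field s) (Field s')"
    "\<And>x y. x \<in> Field s \<Longrightarrow> y \<in> Field s \<Longrightarrow> (x, y) \<in> s \<longleftrightarrow> (g x, g y) \<in> s'"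
    using assms(2) unfolding lo_iso_def by blast
  have "bij_betw (map_sum f g) (Field (lo_plus r s)) (Field (lo_plus r' s'))"
    unfolding Field_lo_plus bij_betw_def
  proof
    show "inj_on (map_sum f g) (Inl ` Field r \<union> Inr ` Field s)"
      using f(1)[THEN bij_betw_imp_inj_on] g(1)[THEN bij_betw_imp_inj_on]
      by (auto intro!: inj_onI dest: inj_onD)
    have "Field r' = f ` Field r" "Field s' = g ` Field s"
      using f(1) g(1) by (simp_all add: bij_betw_def)
    then show "map_sum f g ` (Inl ` Field r \<union> Inr ` Field s) = Inl ` Field r' \<union> Inr ` Field s'"
      by (simp add: image_Un image_image)
  qed
  moreover have "(x, y) \<in> lo_plus r s \<longleftrightarrow> (map_sum f g x, map_sum f g y) \<in> lo_plus r' s'"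
    if "x \<in> Field (lo_plus r s)" "y \<in> Field (lo_plus r s)" for x y
  proof -
    have "f a \<in> Field r'" if "a \<in> Field r" for a using that f(1) by (rule bij_betwE[THEN bspec, rotated])
    moreover have "g b \<in> Field s'" if "b \<in> Field s" for b
      using that g(1) by (rule bij_betwE[THEN bspec, rotated])
    ultimately show ?thesis
      using that f(2) g(2) unfolding Field_lo_plus
      by (cases x; cases y) (simp_all add: lo_plus_def image_iff)
  qed
  ultimately show ?thesis unfolding lo_iso_def by (intro exI[of _ "map_sum f g"]) simp
qed

lemma lo_prod_cong:
  assumes "r \<cong>\<^sub>l r'" "Linear_order r" shows "lo_prod A r \<cong>\<^sub>l lo_prod A r'"
proof -
  obtain f where f: "bij_betw f (Field r) (Field r')"
    "\<And>x y. x \<in> Field r \<Longrightarrow> y \<in> Field r \<Longrightarrow> (x, y) \<in> r \<longleftrightarrow> (f x, f y) \<in> r'"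
    using assms(1) unfolding lo_iso_def by blast
  have F: "Field (lo_prod A r) = Field A \<times> Field r" "Field (lo_prod A r') = Field A \<times> Field r'"
    unfolding lo_prod_def using assms lo_iso_Linear_order[OF assms(2,1)]
    by (subst Field_lo_sum; auto simp: Linear_order_iff)+
  have "bij_betw (map_prod id f) (Field (lo_prod A r)) (Field (lo_prod A r'))"
    unfolding F by (rule bij_betw_map_prod[OF bij_betw_id f(1)])
  moreover have "(x, y) \<in> lo_prod A r \<longleftrightarrow> (map_prod id f x, map_prod id f y) \<in> lo_prod A r'"
    if "x \<in> Field (lo_prod A r)" "y \<in> Field (lo_prod A r)" for x y
  proof -
    have "f a \<in> Field r'" if "a \<in> Field r" for a using that f(1) by (rule bij_betwE[THEN bspec, rotated])
    then show ?thesis using that f(2) unfolding F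
      by (cases x; cases y) (simp add: lo_prod_def lo_sum_def)
  qed
  ultimately show ?thesis unfolding lo_iso_def by (intro exI[of _ "map_prod id f"]) simp
qed

text \<open>A factor of an order on \<open>'b\<close> has a copy on \<open>'b\<close>.\<close>

lemma lo_prod_factor:
  fixes t :: "'b rel"
  assumes r: "Linear_order r" and iso: "lo_prod A r \<cong>\<^sub>l t" and "a \<in> Field A"
  shows "\<exists>r' :: 'b rel. r \<cong>\<^sub>l r'"
proof -
  obtain h where h: "bij_betw h (Field (lo_prod A r)) (Field t)"
    using iso unfolding lo_iso_def by blast
  have "Field (lo_prod A r) = Field A \<times> Field r"
    unfolding lo_prod_def using r by (subst Field_lo_sum; auto simp: Linear_order_iff)
  then have "inj_on (\<lambda>x. h (a, x)) (Field r)"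
    using h \<open>a \<in> Field A\<close> by (auto simp: bij_betw_def inj_on_def)
  then show ?thesis using lo_iso_image by blast
qed

lemma finitely_presented_iso:
  fixes t :: "'b rel"
  assumes "finitely_presented r" "r \<cong>\<^sub>l t" shows "finitely_presented t"
  using assms
proof (induction arbitrary: t rule: finitely_presented.induct)
  case (fp_iso r t0 t)
  then show ?case by (blast intro: lo_iso_trans)
next
  case (fp_zero t)
  then have "Field t = {}" by (auto simp: lo_iso_def bij_betw_def Field_def)
  then have "t = {}" by (auto simp: Field_def)
  then show ?case by (simp add: finitely_presented.fp_zero)
next
  case (fp_one a t)
  have "Field {(a, a)} = {a}" by (auto simp: Field_def)
  then obtain f where f: "Field t = {f a}" "(f a, f a) \<in> t"
    using fp_one by (auto simp: lo_iso_def bij_betw_def)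
  have "t \<subseteq> Field t \<times> Field t" by (auto simp: Field_def)
  then have "t = {(f a, f a)}" using f by auto
  then show ?case by (simp add: finitely_presented.fp_one)
next
  case (fp_plus r s t0 t)
  then have iso: "lo_plus r s \<cong>\<^sub>l t" by (blast intro: lo_iso_trans)
  then obtain h where h: "bij_betw h (Field (lo_plus r s)) (Field t)"
    unfolding lo_iso_def by blast
  have i: "inj_on (h \<circ> Inl) (Field r)" "inj_on (h \<circ> Inr) (Field s)"
    using h by (auto simp: bij_betw_def Field_lo_plus inj_on_def)
  show ?case
    using finitely_presented.fp_plus[OF fp_plus.IH(1)[OF lo_iso_image[OF i(1)]]
        fp_plus.IH(2)[OF lo_iso_image[OF i(2)]]
        lo_iso_trans[OF lo_iso_sym[OF lo_plus_cong[OF lo_iso_image[OF i(1)] lo_iso_image[OF i(2)]]] iso]] .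
next
  case (fp_omega r t0 t)
  then have iso: "lo_prod natLeq r \<cong>\<^sub>l t" by (blast intro: lo_iso_trans)
  have lin: "Linear_order r" using fp_omega by (blast intro: finitely_presented_Linear_order)
  obtain r' :: "'b rel" where r': "r \<cong>\<^sub>l r'"
    using lo_prod_factor[OF lin iso, of 0] by (auto simp: Field_natLeq)
  show ?case
    by (rule finitely_presented.fp_omega[OF fp_omega.IH[OF r']])
       (rule lo_iso_trans[OF lo_iso_sym[OF lo_prod_cong[OF r' lin]] iso])
next
  case (fp_omega_star r t0 t)
  then have iso: "lo_prod (natLeq\<inverse>) r \<cong>\<^sub>l t" by (blast intro: lo_iso_trans)
  have lin: "Linear_order r" using fp_omega_star by (blast intro: finitely_presented_Linear_order)
  obtain r' :: "'b rel" where r': "r \<cong>\<^sub>l r'"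
    using lo_prod_factor[OF lin iso, of 0] by (auto simp: Field_natLeq)
  show ?case
    by (rule finitely_presented.fp_omega_star[OF fp_omega_star.IH[OF r']])
       (rule lo_iso_trans[OF lo_iso_sym[OF lo_prod_cong[OF r' lin]] iso])
qed

lemma finitely_presented_lo_plus:
  assumes "finitely_presented r" "finitely_presented s"
  shows "finitely_presented (lo_plus r s)"
proof -
  have l: "r \<cong>\<^sub>l map_prod Inl Inl ` r" "s \<cong>\<^sub>l map_prod Inr Inr ` s"
    by (auto intro!: lo_iso_image)
  show ?thesis
    by (rule fp_plus[OF finitely_presented_iso[OF assms(1) l(1)]
          finitely_presented_iso[OF assms(2) l(2)] lo_iso_sym[OF lo_plus_cong[OF l]]])
qed

lemma finitely_presented_omega:
  assumes "finitely_presented r"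
  shows "finitely_presented (lo_prod natLeq r)" "finitely_presented (lo_prod (natLeq\<inverse>) r)"
proof -
  have l: "r \<cong>\<^sub>l map_prod (Pair (0 :: nat)) (Pair 0) ` r"
    by (auto intro!: lo_iso_image simp: inj_on_def)
  have lin: "Linear_order r" using assms by (rule finitely_presented_Linear_order)
  show "finitely_presented (lo_prod natLeq r)"
    by (rule fp_omega[OF finitely_presented_iso[OF assms l] lo_iso_sym[OF lo_prod_cong[OF l lin]]])
  show "finitely_presented (lo_prod (natLeq\<inverse>) r)"
    by (rule fp_omega_star[OF finitely_presented_iso[OF assms l] lo_iso_sym[OF lo_prod_cong[OF l lin]]])
qed

section \<open>Signed trees\<close>

definition is_tree :: "nat list set \<Rightarrow> bool" where
  "is_tree T \<longleftrightarrow> T \<noteq> {} \<and> finite T \<and> (\<forall>\<tau>\<in>T. \<forall>\<sigma>. prefix \<sigma> \<tau> \<longrightarrow> \<sigma> \<in> T)"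

definition width :: "nat list set \<Rightarrow> nat list \<Rightarrow> nat" where
  "width T \<sigma> = card {x. \<sigma> @ [x] \<in> T}"

definition standard_labelling :: "nat list set \<Rightarrow> bool" where
  "standard_labelling T \<longleftrightarrow> (\<forall>\<sigma>\<in>T. \<forall>x. \<sigma> @ [x] \<in> T \<longleftrightarrow> x < width T \<sigma>)"

definition is_leaf :: "nat list set \<Rightarrow> nat list \<Rightarrow> bool" where
  "is_leaf T \<sigma> \<longleftrightarrow> \<sigma> \<in> T \<and> (\<forall>x. \<sigma> @ [x] \<notin> T)"

datatype sign = Plus | Minus | Zero

text \<open>Only the values of the sign function on \<open>T\<close> are relevant.\<close>

definition signed_tree3 :: "nat list set \<Rightarrow> (nat list \<Rightarrow> sign) \<Rightarrow> bool" where
  "signed_tree3 T s \<longleftrightarrow>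
     is_tree T \<and> standard_labelling T \<and>
     (\<forall>\<sigma>\<in>T. s \<sigma> = Zero \<longleftrightarrow> \<sigma> = [] \<or> is_leaf T \<sigma>)"

text \<open>The inequality of truth values is exclusive disjunction.\<close>

definition alternating :: "nat list set \<Rightarrow> (nat list \<Rightarrow> sign) \<Rightarrow> bool" where
  "alternating T s \<longleftrightarrow>
     (\<forall>\<sigma>\<in>T. \<not> is_leaf T \<sigma> \<longrightarrow>
        (\<forall>x<width T \<sigma>. s (\<sigma> @ [x]) = Zero) \<noteq>
        (even (width T \<sigma>) \<and>
         (\<forall>x<width T \<sigma>. s (\<sigma> @ [x]) = (if even x then Plus else Minus))))"

fun omega_sign :: "sign \<Rightarrow> nat rel" where
  "omega_sign Plus = natLeq"
| "omega_sign Minus = natLeq\<inverse>"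
| "omega_sign Zero = {(0, 0)}"

section \<open>The linear order of a signed tree\<close>

text \<open>
  The nested products have carriers of varying types; they are all transported to \<open>nat list\<close>
  along the injection below.
\<close>

fun encode :: "nat \<times> nat \<times> nat list \<Rightarrow> nat list" where
  "encode (n, x, v) = n # x # v"

text \<open>
  The guard \<open>finite T \<and> \<sigma> \<in> T\<close> only ensures termination.
  An empty sum is by convention \<open>\<one>\<close>, here on the carrier \<open>{(0, [])}\<close>.
\<close>

function LIN_at :: "nat list set \<Rightarrow> (nat list \<Rightarrow> sign) \<Rightarrow> nat list \<Rightarrow> nat list rel" where
  "LIN_at T s \<sigma> =
     (if finite T \<and> \<sigma> \<in> T then
        map_prod encode encode `
          lo_prod (omega_sign (s \<sigma>))
            (if width T \<sigma> = 0 then {((0, []), (0, []))}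
             else lo_sum (natLeq_on (width T \<sigma>)) (\<lambda>x. LIN_at T s (\<sigma> @ [x])))
      else {})"
  by pat_completeness auto
termination
proof (relation "measure (\<lambda>(T, s, \<sigma>). card {\<tau> \<in> T. length \<sigma> \<le> length \<tau>})")
  fix T :: "nat list set" and s :: "nat list \<Rightarrow> sign" and \<sigma> :: "nat list" and x :: nat
  assume *: "finite T \<and> \<sigma> \<in> T"
  have "{\<tau> \<in> T. length (\<sigma> @ [x]) \<le> length \<tau>} \<subset> {\<tau> \<in> T. length \<sigma> \<le> length \<tau>}"
  proof
    have "\<sigma> \<in> {\<tau> \<in> T. length \<sigma> \<le> length \<tau>}" "\<sigma> \<notin> {\<tau> \<in> T. length (\<sigma> @ [x]) \<le> length \<tau>}"
      using * by auto
    then show "{\<tau> \<in> T. length (\<sigma> @ [x]) \<le> length \<tau>} \<noteq> {\<tau> \<in> T. length \<sigma> \<le> length \<tau>}" by blast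
  qed auto
  then show "((T, s, \<sigma> @ [x]), T, s, \<sigma>) \<in> measure (\<lambda>(T, s, \<sigma>). card {\<tau> \<in> T. length \<sigma> \<le> length \<tau>})"
    using * by (auto intro!: psubset_card_mono)
qed simp

declare LIN_at.simps [simp del]

definition LIN :: "nat list set \<Rightarrow> (nat list \<Rightarrow> sign) \<Rightarrow> nat list rel" where
  "LIN T s = (if card T = 1 then {} else LIN_at T s [])"

end

theory Submission
  imports Defs "HOL-Library.Countable"
begin

text \<open>
  Let \<open>\<A>\<close> be the smallest class of orders that contains \<open>\<one>\<close> and is closed under \<open>A + B\<close> and
  \<open>\<omega> \<times> A + \<omega>\<^sup>* \<times> B\<close>. Its members are bounded and discrete, and every nonempty order of an
  alternating tree is in \<open>\<A>\<close>.

  Every discrete finitely presented order has the form \<open>P + M + Q\<close>, where \<open>P\<close> is empty or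
  \<open>\<omega>\<^sup>* \<times> A\<close>, \<open>M\<close> is empty or in \<open>\<A>\<close>, and \<open>Q\<close> is empty or \<open>\<omega> \<times> B\<close>: for sums one uses that a
  discrete \<open>L + L'\<close> has a maximum in \<open>L\<close> iff it has a minimum in \<open>L'\<close>, for products the identity
  \<open>\<omega> \<times> (X + Y) = X + \<omega> \<times> (Y + X)\<close>, and for \<open>\<omega>\<^sup>*\<close> reversal. If such an order is bounded, then \<open>P\<close>
  and \<open>Q\<close> are empty.

  Conversely, by \<open>\<one> + A \<cong> A \<cong> A + \<one>\<close> for infinite \<open>A\<close>, each member of \<open>\<A>\<close> is either finite or an
  alternating sum of orders \<open>\<omega> \<times> A\<^sub>0 + \<omega>\<^sup>* \<times> A\<^sub>1 + \<dots>\<close>, hence the order of an alternating tree.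
\<close>

section \<open>Isomorphisms and arithmetic of linear orders\<close>

lemma lo_isoI:
  assumes "inj_on f (Field r)" "f ` Field r = Field s"
    "\<And>x y. x \<in> Field r \<Longrightarrow> y \<in> Field r \<Longrightarrow> (x, y) \<in> r \<longleftrightarrow> (f x, f y) \<in> s"
  shows "r \<cong>\<^sub>l s"
  using assms unfolding lo_iso_def bij_betw_def by blast

lemmas [trans] = lo_iso_trans

lemma lo_iso_empty_iff: "r \<cong>\<^sub>l s \<Longrightarrow> r = {} \<longleftrightarrow> s = {}"
  unfolding lo_iso_def bij_betw_def
  by (metis Field_empty empty_is_image FieldI1 equals0D subrelI subset_empty)

lemma lo_iso_singleton: "{(a, a)} \<cong>\<^sub>l {(b, b)}"
  by (rule lo_isoI[where f = "\<lambda>_. b"]) (auto simp: Field_def)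

text \<open>Sums and products change the carrier type. This brings them back to \<open>nat\<close>,
  where the inductive class and the pieces of decompositions live.\<close>

lemma countable_realisation:
  fixes r :: "'b::countable rel"
  shows "\<exists>r' :: nat rel. r \<cong>\<^sub>l r'"
  using lo_iso_image[OF inj_on_subset[OF inj_to_nat subset_UNIV]] by blast

lemma lo_iso_converse: "r \<cong>\<^sub>l s \<Longrightarrow> r\<inverse> \<cong>\<^sub>l s\<inverse>"
  unfolding lo_iso_def by auto

lemma Linear_order_converse: "Linear_order r \<Longrightarrow> Linear_order (r\<inverse>)"
  by simp

lemma Linear_order_singleton: "Linear_order {(a, a)}"
  by (rule finitely_presented_Linear_order[OF fp_one])

lemma Linear_order_empty: "Linear_order {}"
  by (rule finitely_presented_Linear_order[OF fp_zero])

section \<open>Finite segments, and membership in sums and products\<close>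

definition nat_seg :: "nat \<Rightarrow> nat rel" where
  "nat_seg n = natLeq_on n"

lemma Field_nat_seg: "Field (nat_seg n) = {..<n}"
  unfolding nat_seg_def Field_natLeq_on by auto

lemma nat_seg_iff: "(x, y) \<in> nat_seg n \<longleftrightarrow> x \<le> y \<and> y < n"
  by (auto simp: nat_seg_def)

lemma Linear_order_nat_seg: "Linear_order (nat_seg n)"
  unfolding Linear_order_iff
  by (auto simp: Field_nat_seg refl_on_def trans_def antisym_def total_on_def nat_seg_iff)

lemma Linear_order_lo_prod: "Linear_order A \<Longrightarrow> Linear_order r \<Longrightarrow> Linear_order (lo_prod A r)"
  unfolding lo_prod_def by (rule Linear_order_lo_sum)

lemma Field_lo_sum':
  "(\<And>a. a \<in> Field A \<Longrightarrow> Linear_order (B a)) \<Longrightarrow> Field (lo_sum A B) = (SIGMA a:Field A. Field (B a))"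
  by (rule Field_lo_sum) (auto simp: Linear_order_iff)

lemma Field_lo_prod: "Linear_order r \<Longrightarrow> Field (lo_prod A r) = Field A \<times> Field r"
  unfolding lo_prod_def by (rule Field_lo_sum')

lemma lo_plus_simps [simp]:
  "(Inl a, Inl a') \<in> lo_plus r s \<longleftrightarrow> (a, a') \<in> r"
  "(Inr b, Inr b') \<in> lo_plus r s \<longleftrightarrow> (b, b') \<in> s"
  "(Inl a, Inr b) \<in> lo_plus r s \<longleftrightarrow> a \<in> Field r \<and> b \<in> Field s"
  "(Inr b, Inl a) \<notin> lo_plus r s"
  by (auto simp: lo_plus_def)

lemma lo_sum_iff:
  "((a, b), (a', b')) \<in> lo_sum A B \<longleftrightarrow> a \<in> Field A \<and> a' \<in> Field A \<and> b \<in> Field (B a) \<and> b' \<in> Field (B a') \<and>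
    (a \<noteq> a' \<and> (a, a') \<in> A \<or> a = a' \<and> (b, b') \<in> B a)"
  by (simp add: lo_sum_def)

lemma lo_prod_iff:
  "((a, b), (a', b')) \<in> lo_prod A r \<longleftrightarrow> a \<in> Field A \<and> a' \<in> Field A \<and> b \<in> Field r \<and> b' \<in> Field r \<and>
    (a \<noteq> a' \<and> (a, a') \<in> A \<or> a = a' \<and> (b, b') \<in> r)"
  by (simp add: lo_prod_def lo_sum_def)

section \<open>Algebraic laws of sums and products, and their reversal\<close>

lemma lo_plus_assoc: "lo_plus (lo_plus r s) t \<cong>\<^sub>l lo_plus r (lo_plus s t)"
  by (rule lo_isoI[where f = "case_sum (case_sum Inl (Inr \<circ> Inl)) (Inr \<circ> Inr)"])
    (auto simp: Field_lo_plus inj_on_def image_Un image_image)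

lemma lo_plus_empty_left: "lo_plus {} r \<cong>\<^sub>l r"
  by (rule lo_isoI[where f = projr]) (auto simp: Field_lo_plus inj_on_def image_image)

lemma lo_plus_empty_right: "lo_plus r {} \<cong>\<^sub>l r"
  by (rule lo_isoI[where f = projl]) (auto simp: Field_lo_plus inj_on_def image_image)

lemma lo_plus_eq_empty_iff: "lo_plus r s = {} \<longleftrightarrow> r = {} \<and> s = {}"
  by (auto simp: lo_plus_def Field_def)

text \<open>Reversal exchanges the tags \<open>Inl\<close> and \<open>Inr\<close>, hence only an
  isomorphism. Products keep their carrier, so \<open>converse_lo_prod\<close> is an
  equality.\<close>

lemma converse_lo_plus: "(lo_plus r s)\<inverse> \<cong>\<^sub>l lo_plus (s\<inverse>) (r\<inverse>)"
  by (rule lo_isoI[where f = "case_sum Inr Inl"])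
    (auto simp: Field_lo_plus inj_on_def image_Un image_image)

lemma converse_lo_prod: "(lo_prod A r)\<inverse> = lo_prod (A\<inverse>) (r\<inverse>)"
  by (auto simp: lo_prod_def lo_sum_def)

lemma lo_prod_empty: "lo_prod A {} = {}"
  by (auto simp: lo_prod_def lo_sum_def)

lemma lo_prod_singleton_left: "Linear_order r \<Longrightarrow> lo_prod {(a, a)} r \<cong>\<^sub>l r"
  by (rule lo_isoI[where f = snd]) (auto simp: Field_lo_prod inj_on_def lo_prod_iff)

lemma lo_prod_singleton_right: "Linear_order A \<Longrightarrow> lo_prod A {(a, a)} \<cong>\<^sub>l A"
  by (rule lo_isoI[where f = fst])
    (auto simp: Field_lo_prod Linear_order_singleton inj_on_def lo_prod_iff Linear_order_iff
      dest: refl_onD)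

lemma natLeq_iff: "(x, y) \<in> natLeq \<longleftrightarrow> x \<le> y"
  by (simp add: natLeq_def)

text \<open>Both sides list \<open>r, s, r, s, ...\<close>; only the bracketing differs, since the
  first \<open>r\<close> is split off and each remaining \<open>r\<close> is paired with the
  \<open>s\<close> before it.\<close>

lemma omega_rotate:
  assumes "Linear_order r" "Linear_order s"
  shows "lo_prod natLeq (lo_plus r s) \<cong>\<^sub>l lo_plus r (lo_prod natLeq (lo_plus s r))"
proof -
  have F: "Field (lo_prod natLeq (lo_plus r s)) = UNIV \<times> (Inl ` Field r \<union> Inr ` Field s)"
    "Field (lo_prod natLeq (lo_plus s r)) = UNIV \<times> (Inl ` Field s \<union> Inr ` Field r)"
    using assms by (simp_all add: Field_lo_prod Linear_order_lo_plus Field_natLeq flip: Field_lo_plus)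
  \<comment> \<open>The copy of \<open>r\<close> with index \<open>0\<close> moves to the front; the
    one with index \<open>Suc m\<close> becomes the right neighbour of the copy of \<open>s\<close>
    with index \<open>m\<close>.\<close>
  define f :: "nat \<times> ('a + 'b) \<Rightarrow> 'a + nat \<times> ('b + 'a)" where
    "f = (\<lambda>(n, z). case z of Inl x \<Rightarrow> (case n of 0 \<Rightarrow> Inl x | Suc m \<Rightarrow> Inr (m, Inr x))
                             | Inr y \<Rightarrow> Inr (n, Inl y))"
  define g :: "'a + nat \<times> ('b + 'a) \<Rightarrow> nat \<times> ('a + 'b)" where
    "g = case_sum (\<lambda>x. (0, Inl x)) (\<lambda>(n, z). case z of Inl y \<Rightarrow> (n, Inr y) | Inr x \<Rightarrow> (Suc n, Inl x))"
  have gf: "g (f u) = u" and fg: "f (g v) = v" for u v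
    by (auto simp: f_def g_def split: sum.splits nat.splits prod.splits)
  show ?thesis
  proof (rule lo_isoI[where f = f])
    show "inj_on f (Field (lo_prod natLeq (lo_plus r s)))" by (metis inj_on_inverseI gf)
    show "f ` Field (lo_prod natLeq (lo_plus r s)) = Field (lo_plus r (lo_prod natLeq (lo_plus s r)))"
    proof
      show "f ` Field (lo_prod natLeq (lo_plus r s)) \<subseteq> Field (lo_plus r (lo_prod natLeq (lo_plus s r)))"
        by (auto simp: F Field_lo_plus Field_natLeq f_def split: nat.splits sum.splits)
      show "Field (lo_plus r (lo_prod natLeq (lo_plus s r))) \<subseteq> f ` Field (lo_prod natLeq (lo_plus r s))"
      proof
        fix v assume "v \<in> Field (lo_plus r (lo_prod natLeq (lo_plus s r)))"
        then have "g v \<in> Field (lo_prod natLeq (lo_plus r s))"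
          by (auto simp: F Field_lo_plus Field_natLeq g_def)
        then show "v \<in> f ` Field (lo_prod natLeq (lo_plus r s))" by (metis fg imageI)
      qed
    qed
    show "(u, v) \<in> lo_prod natLeq (lo_plus r s) \<longleftrightarrow> (f u, f v) \<in> lo_plus r (lo_prod natLeq (lo_plus s r))"
      if "u \<in> Field (lo_prod natLeq (lo_plus r s))" "v \<in> Field (lo_prod natLeq (lo_plus r s))" for u v
      using that unfolding F
      by (auto simp: F Field_lo_plus Field_natLeq f_def lo_prod_iff natLeq_iff split: nat.splits)
  qed
qed

text \<open>This is \<open>omega_rotate\<close> for the reversed orders, reversed again.\<close>

lemma omega_star_rotate:
  assumes "Linear_order r" "Linear_order s"
  shows "lo_prod (natLeq\<inverse>) (lo_plus r s) \<cong>\<^sub>l lo_plus (lo_prod (natLeq\<inverse>) (lo_plus s r)) s"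
proof -
  note lin = assms Linear_order_converse[OF assms(1)] Linear_order_converse[OF assms(2)]
    Linear_order_lo_plus Linear_order_lo_prod Linear_order_natLeq
  have c: "(lo_plus (t\<inverse>) (u\<inverse>))\<inverse> \<cong>\<^sub>l lo_plus u t" for t :: "'c rel" and u :: "'d rel"
    using converse_lo_plus[of "t\<inverse>" "u\<inverse>"] by simp
  have c': "lo_prod (natLeq\<inverse>) (t\<inverse>) = (lo_prod natLeq t)\<inverse>" for t :: "'c rel"
    by (simp add: converse_lo_prod)
  have "lo_prod (natLeq\<inverse>) (lo_plus r s) \<cong>\<^sub>l lo_prod (natLeq\<inverse>) ((lo_plus (s\<inverse>) (r\<inverse>))\<inverse>)"
    by (intro lo_prod_cong lo_iso_sym[OF c] lin)
  also have "\<dots> = (lo_prod natLeq (lo_plus (s\<inverse>) (r\<inverse>)))\<inverse>" by (rule c')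
  also have "\<dots> \<cong>\<^sub>l (lo_plus (s\<inverse>) (lo_prod natLeq (lo_plus (r\<inverse>) (s\<inverse>))))\<inverse>"
    by (intro lo_iso_converse omega_rotate lin)
  also have "\<dots> \<cong>\<^sub>l lo_plus ((lo_prod natLeq (lo_plus (r\<inverse>) (s\<inverse>)))\<inverse>) s"
    using converse_lo_plus[of "s\<inverse>" "lo_prod natLeq (lo_plus (r\<inverse>) (s\<inverse>))"] by simp
  also have "\<dots> = lo_plus (lo_prod (natLeq\<inverse>) ((lo_plus (r\<inverse>) (s\<inverse>))\<inverse>)) s"
    by (simp add: converse_lo_prod)
  also have "\<dots> \<cong>\<^sub>l lo_plus (lo_prod (natLeq\<inverse>) (lo_plus s r)) s"
    by (intro lo_plus_cong lo_prod_cong lo_iso_refl c) (auto intro!: lin)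
  finally show ?thesis .
qed

section \<open>Sums over an index order and over finite segments\<close>

lemma lo_sum_cong:
  assumes lin: "\<And>a. a \<in> Field A \<Longrightarrow> Linear_order (B a)"
    and iso: "\<And>a. a \<in> Field A \<Longrightarrow> B a \<cong>\<^sub>l B' a"
  shows "lo_sum A B \<cong>\<^sub>l lo_sum A B'"
proof -
  have lin': "Linear_order (B' a)" if "a \<in> Field A" for a
    using lo_iso_Linear_order[OF lin iso] that by blast
  have "\<forall>a\<in>Field A. \<exists>f. bij_betw f (Field (B a)) (Field (B' a)) \<and>
          (\<forall>x\<in>Field (B a). \<forall>y\<in>Field (B a). (x, y) \<in> B a \<longleftrightarrow> (f x, f y) \<in> B' a)"
    using iso unfolding lo_iso_def by blast
  then obtain f where f: "\<And>a. a \<in> Field A \<Longrightarrow> bij_betw (f a) (Field (B a)) (Field (B' a))"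
    "\<And>a x y. a \<in> Field A \<Longrightarrow> x \<in> Field (B a) \<Longrightarrow> y \<in> Field (B a) \<Longrightarrow>
       (x, y) \<in> B a \<longleftrightarrow> (f a x, f a y) \<in> B' a"
    by metis
  have fF: "f a x \<in> Field (B' a)" if "a \<in> Field A" "x \<in> Field (B a)" for a x
    using f(1) that by (auto simp: bij_betw_def)
  have F: "Field (lo_sum A B) = (SIGMA a:Field A. Field (B a))"
    "Field (lo_sum A B') = (SIGMA a:Field A. Field (B' a))"
    using lin lin' by (simp_all add: Field_lo_sum')
  show ?thesis
  proof (rule lo_isoI[where f = "\<lambda>(a, x). (a, f a x)"])
    show "inj_on (\<lambda>(a, x). (a, f a x)) (Field (lo_sum A B))"
      using f(1) unfolding F by (auto simp: inj_on_def bij_betw_def)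
    show "(\<lambda>(a, x). (a, f a x)) ` Field (lo_sum A B) = Field (lo_sum A B')"
      using f(1) unfolding F by (force simp: bij_betw_def)
    show "(u, v) \<in> lo_sum A B \<longleftrightarrow> ((\<lambda>(a, x). (a, f a x)) u, (\<lambda>(a, x). (a, f a x)) v) \<in> lo_sum A B'"
      if "u \<in> Field (lo_sum A B)" "v \<in> Field (lo_sum A B)" for u v
      using that f(2) fF unfolding F by (cases u; cases v) (auto simp: lo_sum_def)
  qed
qed

text \<open>The \<open>if\<close> pastes two families into one, so the same lemma serves to cut a
  finite sum at \<open>m\<close> and to concatenate two finite sums.\<close>

lemma lo_sum_nat_seg_add:
  assumes B: "\<And>x. x < m \<Longrightarrow> Linear_order (B x)" and C: "\<And>x. x < n \<Longrightarrow> Linear_order (C x)"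
  shows "lo_sum (nat_seg (m + n)) (\<lambda>x. if x < m then B x else C (x - m)) \<cong>\<^sub>l
         lo_plus (lo_sum (nat_seg m) B) (lo_sum (nat_seg n) C)"
proof (rule lo_isoI[where f = "\<lambda>(x, b). if x < m then Inl (x, b) else Inr (x - m, b)"])
  have F: "Field (lo_sum (nat_seg m) B) = (SIGMA x:{..<m}. Field (B x))"
    "Field (lo_sum (nat_seg n) C) = (SIGMA x:{..<n}. Field (C x))"
    "Field (lo_sum (nat_seg (m + n)) (\<lambda>x. if x < m then B x else C (x - m))) =
       (SIGMA x:{..<m + n}. Field (if x < m then B x else C (x - m)))"
    using B C by (subst Field_lo_sum'; auto simp: Field_nat_seg)+
  let ?f = "\<lambda>(x, b). if x < m then Inl (x, b) else Inr (x - m, b)"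
  let ?L = "lo_sum (nat_seg (m + n)) (\<lambda>x. if x < m then B x else C (x - m))"
  let ?R = "lo_plus (lo_sum (nat_seg m) B) (lo_sum (nat_seg n) C)"
  show "inj_on ?f (Field ?L)"
    unfolding F by (auto simp: inj_on_def split: if_splits)
  show "?f ` Field ?L = Field ?R"
  proof
    show "?f ` Field ?L \<subseteq> Field ?R"
      unfolding F Field_lo_plus by (auto split: if_splits)
    have "Inl (x, b) \<in> ?f ` Field ?L" if "x < m" "b \<in> Field (B x)" for x b
      using that unfolding F by (intro image_eqI[of _ _ "(x, b)"]) auto
    moreover have "Inr (x, b) \<in> ?f ` Field ?L" if "x < n" "b \<in> Field (C x)" for x b
      using that unfolding F by (intro image_eqI[of _ _ "(x + m, b)"]) auto
    ultimately show "Field ?R \<subseteq> ?f ` Field ?L"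
      unfolding Field_lo_plus F(1,2) by auto
  qed
  show "(u, v) \<in> ?L \<longleftrightarrow> (?f u, ?f v) \<in> ?R" if "u \<in> Field ?L" "v \<in> Field ?L" for u v
    using that unfolding F
    by (cases u; cases v) (auto simp: lo_sum_iff nat_seg_iff Field_nat_seg F split: if_splits)
qed

lemma lo_sum_nat_seg_1:
  assumes "Linear_order (B 0)" shows "lo_sum (nat_seg 1) B \<cong>\<^sub>l B 0"
proof (rule lo_isoI[where f = snd])
  have F: "Field (lo_sum (nat_seg 1) B) = {0} \<times> Field (B 0)"
    using assms by (subst Field_lo_sum') (auto simp: Field_nat_seg)
  show "inj_on snd (Field (lo_sum (nat_seg 1) B))"
    "snd ` Field (lo_sum (nat_seg 1) B) = Field (B 0)"
    unfolding F by (auto simp: inj_on_def)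
  show "(u, v) \<in> lo_sum (nat_seg 1) B \<longleftrightarrow> (snd u, snd v) \<in> B 0"
    if "u \<in> Field (lo_sum (nat_seg 1) B)" "v \<in> Field (lo_sum (nat_seg 1) B)" for u v
    using that unfolding F by (cases u; cases v) (auto simp: lo_sum_iff nat_seg_iff Field_nat_seg)
qed

text \<open>A segment is the sum of one-point orders indexed by itself, so cutting the index order
  cuts the segment.\<close>

lemma nat_seg_add: "nat_seg (m + n) \<cong>\<^sub>l lo_plus (nat_seg m) (nat_seg n)"
proof -
  have s: "nat_seg k \<cong>\<^sub>l lo_sum (nat_seg k) (\<lambda>_. {(0::nat, 0)})" for k
    using lo_iso_sym[OF lo_prod_singleton_right[OF Linear_order_nat_seg]]
    unfolding lo_prod_def .
  have "nat_seg (m + n) \<cong>\<^sub>l lo_sum (nat_seg (m + n)) (\<lambda>_. {(0::nat, 0)})" by (rule s)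
  also have "\<dots> \<cong>\<^sub>l lo_plus (lo_sum (nat_seg m) (\<lambda>_. {(0::nat, 0)})) (lo_sum (nat_seg n) (\<lambda>_. {(0::nat, 0)}))"
    using lo_sum_nat_seg_add[of m "\<lambda>_. {(0::nat, 0)}" n "\<lambda>_. {(0::nat, 0)}"]
    by (simp add: Linear_order_singleton)
  also have "\<dots> \<cong>\<^sub>l lo_plus (nat_seg m) (nat_seg n)"
    by (intro lo_plus_cong lo_iso_sym[OF s])
  finally show ?thesis .
qed

section \<open>Endpoints and immediate neighbours\<close>

definition has_min :: "'a rel \<Rightarrow> bool" where "has_min r \<longleftrightarrow> (\<exists>m. lo_min r m)"
definition has_max :: "'a rel \<Rightarrow> bool" where "has_max r \<longleftrightarrow> (\<exists>m. lo_max r m)"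

text \<open>One half of discreteness. The other half is the same property of the reversed order, so
  only statements about successors need a direct proof.\<close>

definition has_succs :: "'a rel \<Rightarrow> bool" where
  "has_succs r \<longleftrightarrow> (\<forall>x\<in>Field r. \<not> lo_max r x \<longrightarrow> (\<exists>y. lo_covers r x y))"

lemma has_succsD:
  "has_succs r \<Longrightarrow> x \<in> Field r \<Longrightarrow> \<not> lo_max r x \<Longrightarrow> \<exists>y. lo_covers r x y"
  by (simp add: has_succs_def)

lemma lo_max_converse: "lo_max (r\<inverse>) = lo_min r"
  by (auto simp: lo_max_def lo_min_def fun_eq_iff)

lemma lo_min_converse: "lo_min (r\<inverse>) = lo_max r"
  by (auto simp: lo_max_def lo_min_def fun_eq_iff)

lemma has_max_converse [simp]: "has_max (r\<inverse>) \<longleftrightarrow> has_min r"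
  by (simp add: has_max_def has_min_def lo_max_converse)

lemma has_min_converse [simp]: "has_min (r\<inverse>) \<longleftrightarrow> has_max r"
  by (simp add: has_max_def has_min_def lo_min_converse)

lemma lo_bounded_iff: "lo_bounded r \<longleftrightarrow> has_min r \<and> has_max r"
  by (simp add: lo_bounded_def has_min_def has_max_def)

lemma lo_covers_converse: "lo_covers (r\<inverse>) x y \<longleftrightarrow> lo_covers r y x"
  by (auto simp: lo_covers_def)

lemma lo_discrete_iff: "lo_discrete r \<longleftrightarrow> has_succs r \<and> has_succs (r\<inverse>)"
  by (simp add: lo_discrete_def has_succs_def lo_max_converse lo_covers_converse)

lemma lo_discrete_converse [simp]: "lo_discrete (r\<inverse>) \<longleftrightarrow> lo_discrete r"
  by (auto simp: lo_discrete_iff)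

section \<open>Invariance under isomorphism\<close>

lemma has_max_iso_imp:
  assumes "r \<cong>\<^sub>l s" "has_max r" shows "has_max s"
proof -
  obtain f where f: "bij_betw f (Field r) (Field s)"
    "\<And>x y. x \<in> Field r \<Longrightarrow> y \<in> Field r \<Longrightarrow> (x, y) \<in> r \<longleftrightarrow> (f x, f y) \<in> s"
    using assms unfolding lo_iso_def by blast
  have Fs: "Field s = f ` Field r" using f(1) by (auto simp: bij_betw_def)
  obtain m where "lo_max r m" using assms unfolding has_max_def by blast
  then have "lo_max s (f m)" using f(2) unfolding lo_max_def Fs by auto
  then show ?thesis unfolding has_max_def by blast
qed

lemma has_max_iso: "r \<cong>\<^sub>l s \<Longrightarrow> has_max r \<longleftrightarrow> has_max s"
  by (rule iffI) (erule has_max_iso_imp, assumption, erule has_max_iso_imp[OF lo_iso_sym], assumption)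

lemma has_min_iso: "r \<cong>\<^sub>l s \<Longrightarrow> has_min r \<longleftrightarrow> has_min s"
  using has_max_iso[OF lo_iso_converse, of r s] by simp

lemma has_succs_iso: "r \<cong>\<^sub>l s \<Longrightarrow> has_succs r \<Longrightarrow> has_succs s"
proof -
  assume "r \<cong>\<^sub>l s" and succs: "has_succs r"
  then obtain f where f: "bij_betw f (Field r) (Field s)"
    "\<And>x y. x \<in> Field r \<Longrightarrow> y \<in> Field r \<Longrightarrow> (x, y) \<in> r \<longleftrightarrow> (f x, f y) \<in> s"
    unfolding lo_iso_def by blast
  have inj: "f x = f y \<longleftrightarrow> x = y" if "x \<in> Field r" "y \<in> Field r" for x y
    using f(1) that by (auto simp: bij_betw_def inj_on_def)
  have Fs: "Field s = f ` Field r" using f(1) by (auto simp: bij_betw_def)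
  show "has_succs s" unfolding has_succs_def
  proof (intro ballI impI)
    fix u assume "u \<in> Field s" and nmax: "\<not> lo_max s u"
    then obtain x where x: "x \<in> Field r" "u = f x" using Fs by auto
    have "\<not> lo_max r x" using nmax x f(2) unfolding lo_max_def Fs by auto
    then obtain y where y: "lo_covers r x y" using succs x unfolding has_succs_def by blast
    then have yF: "y \<in> Field r" by (auto simp: lo_covers_def Field_def)
    have "lo_covers s (f x) (f y)"
      unfolding lo_covers_def
    proof (intro conjI notI)
      show "(f x, f y) \<in> s" using y x yF f(2) by (auto simp: lo_covers_def)
      show "f x = f y \<Longrightarrow> False" using y inj x yF by (auto simp: lo_covers_def)
      assume "\<exists>z. (f x, z) \<in> s \<and> (z, f y) \<in> s \<and> z \<noteq> f x \<and> z \<noteq> f y"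
      then obtain z where z: "(f x, z) \<in> s" "(z, f y) \<in> s" "z \<noteq> f x" "z \<noteq> f y" by blast
      then have "z \<in> Field s" by (auto simp: Field_def)
      then obtain w where w: "w \<in> Field r" "z = f w" using Fs by auto
      then have "(x, w) \<in> r" "(w, y) \<in> r" "w \<noteq> x" "w \<noteq> y" using z f(2) x yF by auto
      then show False using y by (auto simp: lo_covers_def)
    qed
    then show "\<exists>y. lo_covers s u y" using x by blast
  qed
qed

lemma lo_discrete_iso: "r \<cong>\<^sub>l s \<Longrightarrow> lo_discrete r \<Longrightarrow> lo_discrete s"
  unfolding lo_discrete_iff by (blast intro: has_succs_iso[of r s] has_succs_iso[of "r\<inverse>" "s\<inverse>"] lo_iso_converse)

lemma Linear_orderD:
  assumes "Linear_order r"
  shows "x \<in> Field r \<Longrightarrow> (x, x) \<in> r"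
    "(x, y) \<in> r \<Longrightarrow> (y, z) \<in> r \<Longrightarrow> (x, z) \<in> r"
    "(x, y) \<in> r \<Longrightarrow> (y, x) \<in> r \<Longrightarrow> x = y"
    "x \<in> Field r \<Longrightarrow> y \<in> Field r \<Longrightarrow> (x, y) \<in> r \<or> (y, x) \<in> r"
proof -
  have "refl_on (Field r) r" "trans r" "antisym r" "total_on (Field r) r"
    using assms unfolding Linear_order_iff by auto
  then show "x \<in> Field r \<Longrightarrow> (x, x) \<in> r" "(x, y) \<in> r \<Longrightarrow> (y, z) \<in> r \<Longrightarrow> (x, z) \<in> r"
    "(x, y) \<in> r \<Longrightarrow> (y, x) \<in> r \<Longrightarrow> x = y"
    "x \<in> Field r \<Longrightarrow> y \<in> Field r \<Longrightarrow> (x, y) \<in> r \<or> (y, x) \<in> r"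
    by (metis refl_onD, metis transD, metis antisymD, metis refl_onD total_on_def)
qed

lemma Field_eq_empty_iff: "Field r = {} \<longleftrightarrow> r = {}"
  by (auto simp: Field_def)

lemma converse_eq_empty_iff [simp]: "r\<inverse> = {} \<longleftrightarrow> r = {}"
  by auto

section \<open>Endpoints and successors in sums\<close>

lemma lo_max_lo_plus [simp]:
  "lo_max (lo_plus r s) (Inl x) \<longleftrightarrow> s = {} \<and> lo_max r x"
  "lo_max (lo_plus r s) (Inr y) \<longleftrightarrow> lo_max s y"
  unfolding lo_max_def Field_lo_plus Field_eq_empty_iff[of s, symmetric] by (auto simp: ball_Un)

lemma has_max_lo_plus: "has_max (lo_plus r s) \<longleftrightarrow> has_max s \<or> s = {} \<and> has_max r"
  by (auto simp: has_max_def split_sum_ex)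

lemma has_min_lo_plus: "has_min (lo_plus r s) \<longleftrightarrow> has_min r \<or> r = {} \<and> has_min s"
  using has_max_iso[OF converse_lo_plus[of r s]] by (simp add: has_max_lo_plus)

lemma lo_covers_lo_plus:
  shows "lo_covers (lo_plus r s) (Inl x) (Inl x') \<longleftrightarrow> lo_covers r x x'"
    "lo_covers (lo_plus r s) (Inr y) (Inr y') \<longleftrightarrow> lo_covers s y y'"
  unfolding lo_covers_def by (auto simp: split_sum_ex)

text \<open>Covers inside a summand are those of the summand. The only new situation is a maximum of
  \<open>r\<close> followed by a nonempty \<open>s\<close>: its successor can only be the minimum of
  \<open>s\<close>.\<close>

lemma has_succs_lo_plus:
  assumes lin: "Linear_order r" "Linear_order s"
  shows "has_succs (lo_plus r s) \<longleftrightarrow> has_succs r \<and> has_succs s \<and> (has_max r \<and> s \<noteq> {} \<longrightarrow> has_min s)"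
    (is "?L \<longleftrightarrow> ?R")
proof
  note linr = Linear_orderD[OF lin(1)] and lins = Linear_orderD[OF lin(2)]
  { assume L: ?L
    have "\<exists>y. lo_covers r x y" if x: "x \<in> Field r" "\<not> lo_max r x" for x
    proof -
      have "Inl x \<in> Field (lo_plus r s)" "\<not> lo_max (lo_plus r s) (Inl x)"
        using x by (auto simp: Field_lo_plus)
      then obtain z where z: "lo_covers (lo_plus r s) (Inl x) z" using has_succsD[OF L] by blast
      \<comment> \<open>This \<open>x'\<close> lies strictly above \<open>x\<close> in
        \<open>r\<close>, so it would separate \<open>x\<close> from any cover lying in
        \<open>s\<close>.\<close>
      obtain x' where x': "x' \<in> Field r" "(x', x) \<notin> r" using x by (auto simp: lo_max_def)
      then have "(x, x') \<in> r" "x \<noteq> x'" using linr(1,4) x by metis+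
      then have *: "(Inl x, Inl x') \<in> lo_plus r s" by simp
      show ?thesis
      proof (cases z)
        case (Inl y)
        then show ?thesis using z lo_covers_lo_plus(1) by metis
      next
        case (Inr b)
        then have "(Inl x', z) \<in> lo_plus r s" using z x' by (simp add: lo_covers_def)
        then show ?thesis using z * Inr \<open>x \<noteq> x'\<close> unfolding lo_covers_def by blast
      qed
    qed
    moreover have "\<exists>y. lo_covers s x y" if x: "x \<in> Field s" "\<not> lo_max s x" for x
    proof -
      have "Inr x \<in> Field (lo_plus r s)" "\<not> lo_max (lo_plus r s) (Inr x)"
        using x by (auto simp: Field_lo_plus)
      then obtain z where z: "lo_covers (lo_plus r s) (Inr x) z" using has_succsD[OF L] by blast
      then have "(Inr x, z) \<in> lo_plus r s" by (simp add: lo_covers_def)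
      then obtain y where "z = Inr y" by (cases z) auto
      then show ?thesis using z lo_covers_lo_plus(2) by metis
    qed
    moreover have "has_min s" if m: "lo_max r m" and "s \<noteq> {}" for m
    proof -
      have "Inl m \<in> Field (lo_plus r s)" using m by (simp add: Field_lo_plus lo_max_def)
      moreover have "\<not> lo_max (lo_plus r s) (Inl m)" using \<open>s \<noteq> {}\<close> by simp
      ultimately obtain z where z: "lo_covers (lo_plus r s) (Inl m) z" using has_succsD[OF L] by metis
      have zm: "(Inl m, z) \<in> lo_plus r s" "Inl m \<noteq> z" using z by (simp_all add: lo_covers_def)
      obtain w where w: "z = Inr w"
      proof (cases z)
        case (Inl x)
        then have "(m, x) \<in> r" "(x, m) \<in> r" using zm m by (auto simp: lo_max_def FieldI2)
        then show ?thesis using linr(3) zm Inl by blast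
      qed
      have "w \<in> Field s" using zm w by simp
      \<comment> \<open>The successor \<open>w\<close> of the maximum of \<open>r\<close> is least
        in \<open>s\<close>: anything smaller would lie strictly between them.\<close>
      have "(w, v) \<in> s" if "v \<in> Field s" for v
      proof (rule ccontr)
        assume "(w, v) \<notin> s"
        then have "(v, w) \<in> s" "v \<noteq> w" using lins(1,4) that \<open>w \<in> Field s\<close> by metis+
        then have "(Inl m, Inr v) \<in> lo_plus r s" "(Inr v, z) \<in> lo_plus r s" "Inr v \<noteq> z"
          using m w that by (auto simp: lo_max_def)
        then show False using z unfolding lo_covers_def by blast
      qed
      then show ?thesis using \<open>w \<in> Field s\<close> unfolding has_min_def lo_min_def by blast
    qed
    ultimately show ?R by (auto simp: has_succs_def[of r] has_succs_def[of s] has_max_def) }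
  { assume R: ?R
    show ?L unfolding has_succs_def
    proof (intro ballI impI)
      fix z assume z: "z \<in> Field (lo_plus r s)" "\<not> lo_max (lo_plus r s) z"
      show "\<exists>y. lo_covers (lo_plus r s) z y"
      proof (cases z)
        case (Inr y)
        then have "y \<in> Field s" "\<not> lo_max s y" using z by (auto simp: Field_lo_plus)
        then obtain y' where "lo_covers s y y'" using R has_succsD by metis
        then show ?thesis using Inr lo_covers_lo_plus(2) by metis
      next
        case (Inl x)
        then have xF: "x \<in> Field r" using z by (auto simp: Field_lo_plus)
        show ?thesis
        proof (cases "lo_max r x")
          case False
          then obtain x' where "lo_covers r x x'" using xF R has_succsD by metis
          then show ?thesis using Inl lo_covers_lo_plus(1) by metis
        next
          case True
          then have "s \<noteq> {}" using z Inl by auto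
          then obtain m where m: "lo_min s m" using R True by (auto simp: has_max_def has_min_def)
          have "lo_covers (lo_plus r s) (Inl x) (Inr m)"
            unfolding lo_covers_def
          proof (intro conjI notI)
            assume "\<exists>z. (Inl x, z) \<in> lo_plus r s \<and> (z, Inr m) \<in> lo_plus r s \<and> z \<noteq> Inl x \<and> z \<noteq> Inr m"
            then obtain z where zz: "(Inl x, z) \<in> lo_plus r s" "(z, Inr m) \<in> lo_plus r s" "z \<noteq> Inl x" "z \<noteq> Inr m"
              by blast
            show False
            proof (cases z)
              case (Inl a)
              then have "(x, a) \<in> r" "(a, x) \<in> r" "a \<noteq> x"
                using zz True by (auto simp: lo_max_def FieldI2)
              then show False using linr(3) by blast
            next
              case (Inr b)
              then have "(b, m) \<in> s" "(m, b) \<in> s" "b \<noteq> m"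
                using zz m by (auto simp: lo_min_def FieldI1)
              then show False using lins(3) by blast
            qed
          qed (use m xF in \<open>auto simp: lo_min_def\<close>)
          then show ?thesis using Inl by blast
        qed
      qed
    qed }
qed

text \<open>Successors give one implication of the seam condition; predecessors, treated as
  successors of the reversed sum, give the other.\<close>

lemma lo_discrete_lo_plus:
  assumes lin: "Linear_order r" "Linear_order s"
  shows "lo_discrete (lo_plus r s) \<longleftrightarrow> lo_discrete r \<and> lo_discrete s \<and>
    (r \<noteq> {} \<and> s \<noteq> {} \<longrightarrow> (has_max r \<longleftrightarrow> has_min s))"
proof -
  have "has_succs ((lo_plus r s)\<inverse>) \<longleftrightarrow> has_succs (lo_plus (s\<inverse>) (r\<inverse>))"
    using has_succs_iso[OF converse_lo_plus] has_succs_iso[OF lo_iso_sym[OF converse_lo_plus]] by blast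
  also have "\<dots> \<longleftrightarrow> has_succs (s\<inverse>) \<and> has_succs (r\<inverse>) \<and> (has_min s \<and> r \<noteq> {} \<longrightarrow> has_max r)"
    using lin by (simp add: has_succs_lo_plus)
  finally have *: "has_succs ((lo_plus r s)\<inverse>) \<longleftrightarrow> \<dots>" .
  \<comment> \<open>An order with an endpoint is nonempty, which reconciles the one-sided emptiness
    conditions of the two halves with the joint one.\<close>
  have "has_max r \<Longrightarrow> r \<noteq> {}" "has_min s \<Longrightarrow> s \<noteq> {}"
    by (auto simp: has_max_def has_min_def lo_max_def lo_min_def)
  then show ?thesis using lin unfolding lo_discrete_iff * by (auto simp: has_succs_lo_plus)
qed

section \<open>Endpoints and successors in products\<close>

lemma has_max_lo_prod:
  assumes A: "Linear_order A" and r: "Linear_order r"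
  shows "has_max (lo_prod A r) \<longleftrightarrow> has_max A \<and> has_max r"
proof -
  have "lo_max (lo_prod A r) (a, x) \<longleftrightarrow> lo_max A a \<and> lo_max r x" for a x
  proof
    assume L: "lo_max (lo_prod A r) (a, x)"
    then have F: "a \<in> Field A" "x \<in> Field r" by (auto simp: lo_max_def Field_lo_prod r)
    have "(b, a) \<in> A" if "b \<in> Field A" for b
    proof -
      have "((b, x), (a, x)) \<in> lo_prod A r" using L F that by (auto simp: lo_max_def Field_lo_prod r)
      then show ?thesis using Linear_orderD(1)[OF A] F by (auto simp: lo_prod_iff)
    qed
    moreover have "(y, x) \<in> r" if "y \<in> Field r" for y
      using L F that by (auto simp: lo_max_def Field_lo_prod r lo_prod_iff)
    ultimately show "lo_max A a \<and> lo_max r x" using F by (auto simp: lo_max_def)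
  qed (auto simp: lo_max_def Field_lo_prod r lo_prod_iff)
  then show ?thesis unfolding has_max_def by auto
qed

lemma has_min_lo_prod:
  assumes "Linear_order A" "Linear_order r"
  shows "has_min (lo_prod A r) \<longleftrightarrow> has_min A \<and> has_min r"
  using has_max_lo_prod[of "A\<inverse>" "r\<inverse>"] assms by (simp flip: converse_lo_prod)

text \<open>Within one copy of \<open>r\<close>, successors are those of \<open>r\<close>; the last
  point of a copy must be followed by the first point of the copy at the next index. The non-maximal
  index \<open>a\<close> ensures that there is a copy with another one after it.\<close>

lemma has_succs_lo_prod:
  assumes A: "Linear_order A" and r: "Linear_order r" and succsA: "has_succs A"
    and a: "a \<in> Field A" "\<not> lo_max A a"
  shows "has_succs (lo_prod A r) \<longleftrightarrow> has_succs r \<and> (has_max r \<longrightarrow> has_min r)"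
    (is "?L \<longleftrightarrow> ?R")
proof
  note linA = Linear_orderD[OF A] and linr = Linear_orderD[OF r]
  note [simp] = Field_lo_prod[OF r]
  obtain a' where a': "a' \<in> Field A" "(a, a') \<in> A" "a \<noteq> a'"
    using a linA(1,4) unfolding lo_max_def by metis
  { assume L: ?L
    have "\<exists>y. lo_covers r x y" if x: "x \<in> Field r" "\<not> lo_max r x" for x
    proof -
      obtain x' where x': "x' \<in> Field r" "(x, x') \<in> r" "x \<noteq> x'"
        using x linr(1,4) unfolding lo_max_def by metis
      have "(a, x) \<in> Field (lo_prod A r)" "\<not> lo_max (lo_prod A r) (a, x)"
        using a x by (auto simp: lo_max_def lo_prod_iff)
      then obtain b y where by': "lo_covers (lo_prod A r) (a, x) (b, y)" using has_succsD[OF L] by fast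
      \<comment> \<open>If the cover lay in another copy, \<open>(a, x')\<close> would separate it
        from \<open>(a, x)\<close>.\<close>
      have "b = a"
      proof (rule ccontr)
        assume "b \<noteq> a"
        then have "((a, x), (a, x')) \<in> lo_prod A r" "((a, x'), (b, y)) \<in> lo_prod A r"
          using by' x' a by (auto simp: lo_covers_def lo_prod_iff)
        then show False using by' x' \<open>b \<noteq> a\<close> unfolding lo_covers_def by blast
      qed
      have "lo_covers r x y"
        unfolding lo_covers_def
      proof (intro conjI notI)
        show "(x, y) \<in> r" "x = y \<Longrightarrow> False" using by' \<open>b = a\<close> by (auto simp: lo_covers_def lo_prod_iff)
        assume "\<exists>z. (x, z) \<in> r \<and> (z, y) \<in> r \<and> z \<noteq> x \<and> z \<noteq> y"
        then obtain z where z: "(x, z) \<in> r" "(z, y) \<in> r" "z \<noteq> x" "z \<noteq> y" by blast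
        then have "((a, x), (a, z)) \<in> lo_prod A r" "((a, z), (a, y)) \<in> lo_prod A r"
          using a by (auto simp: lo_prod_iff FieldI1 FieldI2)
        then show False using z by' \<open>b = a\<close> unfolding lo_covers_def by blast
      qed
      then show ?thesis ..
    qed
    moreover have "has_min r" if m: "lo_max r m" for m
    proof -
      have mF: "m \<in> Field r" using m by (auto simp: lo_max_def)
      have "((a', m), (a, m)) \<notin> lo_prod A r" using a' linA(3) by (auto simp: lo_prod_iff)
      then have "(a, m) \<in> Field (lo_prod A r)" "\<not> lo_max (lo_prod A r) (a, m)"
        using a a' mF by (auto simp: lo_max_def)
      then obtain b y where by': "lo_covers (lo_prod A r) (a, m) (b, y)" using has_succsD[OF L] by fast
      have yF: "y \<in> Field r" "b \<in> Field A" using by' by (auto simp: lo_covers_def lo_prod_iff)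
      have ab: "(a, b) \<in> A" "a \<noteq> b"
        using by' m linr(3) linA(1) by (auto simp: lo_covers_def lo_prod_iff lo_max_def)
      \<comment> \<open>The cover of the last point of copy \<open>a\<close> lies in a later copy
        \<open>b\<close>; a point of copy \<open>b\<close> before \<open>(b, y)\<close> would lie in
        between, so \<open>y\<close> is least in \<open>r\<close>.\<close>
      have "(y, z) \<in> r" if "z \<in> Field r" for z
      proof (rule ccontr)
        assume "(y, z) \<notin> r"
        then have "(z, y) \<in> r" "z \<noteq> y" using linr(1,4) that yF by metis+
        then have "((a, m), (b, z)) \<in> lo_prod A r" "((b, z), (b, y)) \<in> lo_prod A r" "(b, z) \<noteq> (a, m)" "(b, z) \<noteq> (b, y)"
          using ab a mF yF that by (auto simp: lo_prod_iff)
        then show False using by' unfolding lo_covers_def by blast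
      qed
      then show ?thesis using yF unfolding has_min_def lo_min_def by blast
    qed
    ultimately show ?R unfolding has_succs_def has_max_def by blast }
  { assume R: ?R
    show ?L unfolding has_succs_def
    proof (intro ballI impI)
      fix u assume u: "u \<in> Field (lo_prod A r)" "\<not> lo_max (lo_prod A r) u"
      obtain b x where bx: "u = (b, x)" "b \<in> Field A" "x \<in> Field r" using u by (cases u) auto
      show "\<exists>v. lo_covers (lo_prod A r) u v"
      proof (cases "lo_max r x")
        case False
        then obtain y where y: "lo_covers r x y" using R bx has_succsD by metis
        then have "lo_covers (lo_prod A r) (b, x) (b, y)"
          using bx linA(3) by (auto simp: lo_covers_def lo_prod_iff FieldI2)
        then show ?thesis using bx by blast
      next
        case True
        then have "\<not> lo_max A b" using u bx by (auto simp: lo_max_def lo_prod_iff)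
        then obtain c where c: "lo_covers A b c" using succsA bx has_succsD by metis
        obtain m where m: "lo_min r m" using R True by (auto simp: has_max_def has_min_def)
        have "lo_covers (lo_prod A r) (b, x) (c, m)"
          using bx c m True linr(3) linA(3)
          by (auto simp: lo_covers_def lo_prod_iff FieldI2 lo_min_def lo_max_def)
        then show ?thesis using bx by blast
      qed
    qed }
qed

lemma has_succs_natLeq: "has_succs natLeq" "has_succs (natLeq\<inverse>)"
proof -
  have "lo_covers natLeq n (Suc n)" for n by (auto simp: lo_covers_def natLeq_iff)
  moreover have "\<exists>k. lo_covers (natLeq\<inverse>) n k" if "\<not> lo_max (natLeq\<inverse>) n" for n
    using that by (cases n) (auto simp: lo_max_def lo_covers_def natLeq_iff Field_natLeq intro!: exI[of _ "n - 1"])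
  ultimately show "has_succs natLeq" "has_succs (natLeq\<inverse>)" unfolding has_succs_def by blast+
qed

lemma natLeq_ends: "has_min natLeq" "\<not> has_max natLeq"
proof -
  show "has_min natLeq" unfolding has_min_def lo_min_def by (auto simp: natLeq_def Field_def)
  have "\<not> lo_max natLeq m" for m
  proof
    assume "lo_max natLeq m"
    then have "(Suc m, m) \<in> natLeq" by (auto simp: lo_max_def Field_natLeq)
    then show False by (simp add: natLeq_def)
  qed
  then show "\<not> has_max natLeq" by (simp add: has_max_def)
qed

text \<open>Where two copies of \<open>r\<close> meet, existence of successors asks that a maximum
  entail a minimum; predecessors ask for the converse.\<close>

lemma lo_discrete_lo_prod:
  assumes "Linear_order r"
  shows "lo_discrete (lo_prod natLeq r) \<longleftrightarrow> lo_discrete r \<and> (has_max r \<longleftrightarrow> has_min r)"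
    and "lo_discrete (lo_prod (natLeq\<inverse>) r) \<longleftrightarrow> lo_discrete r \<and> (has_max r \<longleftrightarrow> has_min r)"
proof -
  have *: "has_succs (lo_prod natLeq s) \<longleftrightarrow> has_succs s \<and> (has_max s \<longrightarrow> has_min s)"
    if "Linear_order s" for s :: "'c rel"
    using has_succs_lo_prod[OF Linear_order_natLeq(1) that has_succs_natLeq(1), of 0] natLeq_ends
    by (auto simp: Field_natLeq has_max_def)
  \<comment> \<open>In the reversed order \<open>0\<close> is the maximum, so the required
    non-maximal index is \<open>1\<close> here.\<close>
  have "\<not> lo_max (natLeq\<inverse>) 1" by (auto simp: lo_max_def natLeq_def Field_def)
  then have **: "has_succs (lo_prod (natLeq\<inverse>) s) \<longleftrightarrow> has_succs s \<and> (has_max s \<longrightarrow> has_min s)"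
    if "Linear_order s" for s :: "'c rel"
    using has_succs_lo_prod[OF Linear_order_natLeq(2) that has_succs_natLeq(2), of 1]
    by (auto simp: Field_natLeq)
  show "lo_discrete (lo_prod natLeq r) \<longleftrightarrow> lo_discrete r \<and> (has_max r \<longleftrightarrow> has_min r)"
    "lo_discrete (lo_prod (natLeq\<inverse>) r) \<longleftrightarrow> lo_discrete r \<and> (has_max r \<longleftrightarrow> has_min r)"
    using assms unfolding lo_discrete_iff converse_lo_prod by (auto simp: * **)
qed

section \<open>Decomposing discrete finitely presented orders\<close>

text \<open>
  The type \<open>nat\<close> is a universal carrier: all orders that occur are countable, so sums and
  products can be realised on it.
\<close>

inductive alternating_order_nat :: "nat rel \<Rightarrow> bool" where
  alternating_order_nat_one: "alternating_order_nat {(a, a)}"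
| alternating_order_nat_plus: "alternating_order_nat r \<Longrightarrow> alternating_order_nat s \<Longrightarrow> lo_plus r s \<cong>\<^sub>l t \<Longrightarrow> alternating_order_nat t"
| alternating_order_nat_block: "alternating_order_nat r \<Longrightarrow> alternating_order_nat s \<Longrightarrow>
    lo_plus (lo_prod natLeq r) (lo_prod (natLeq\<inverse>) s) \<cong>\<^sub>l t \<Longrightarrow> alternating_order_nat t"

text \<open>The inductive class has the fixed carrier \<open>nat\<close>; closing it under
  isomorphism makes it available on every carrier type.\<close>

definition alternating_order :: "'a rel \<Rightarrow> bool" where
  "alternating_order r \<longleftrightarrow> (\<exists>t. alternating_order_nat t \<and> t \<cong>\<^sub>l r)"

lemma alternating_order_iso: "alternating_order r \<Longrightarrow> r \<cong>\<^sub>l s \<Longrightarrow> alternating_order s"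
  unfolding alternating_order_def using lo_iso_trans by metis

lemma alternating_order_nat_imp_alt: "alternating_order_nat r \<Longrightarrow> alternating_order r"
  unfolding alternating_order_def using lo_iso_refl by metis

lemma Linear_order_block:
  "Linear_order r \<Longrightarrow> Linear_order s \<Longrightarrow>
    Linear_order (lo_plus (lo_prod natLeq r) (lo_prod (natLeq\<inverse>) s))"
  by (intro Linear_order_lo_plus Linear_order_lo_prod Linear_order_natLeq)

text \<open>For a block the seam condition holds because both sides of it fail: the
  \<open>\<omega>\<close> part has no maximum and the \<open>\<omega>\<^sup>*\<close> part has no
  minimum. For a sum of two members both sides hold.\<close>

lemma alternating_order_nat_bounded_discrete:
  "alternating_order_nat r \<Longrightarrow> Linear_order r \<and> has_min r \<and> has_max r \<and> lo_discrete r"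
proof (induction rule: alternating_order_nat.induct)
  case (alternating_order_nat_one a)
  have "Field {(a, a)} = {a}" by (auto simp: Field_def)
  then show ?case
    using Linear_order_singleton[of a]
    by (auto simp: has_min_def has_max_def lo_min_def lo_max_def lo_discrete_def)
next
  case (alternating_order_nat_plus r s t)
  then have "Linear_order (lo_plus r s) \<and> has_min (lo_plus r s) \<and> has_max (lo_plus r s) \<and>
      lo_discrete (lo_plus r s)"
    by (simp add: Linear_order_lo_plus has_min_lo_plus has_max_lo_plus lo_discrete_lo_plus)
  then show ?case
    using alternating_order_nat_plus.hyps lo_iso_Linear_order has_min_iso has_max_iso lo_discrete_iso by metis
next
  case (alternating_order_nat_block r s t)
  let ?b = "lo_plus (lo_prod natLeq r) (lo_prod (natLeq\<inverse>) s)"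
  have "Linear_order ?b" using alternating_order_nat_block Linear_order_block by blast
  moreover have "has_min ?b \<and> has_max ?b \<and> lo_discrete ?b"
    using alternating_order_nat_block.IH Linear_order_natLeq
    by (simp add: Linear_order_lo_prod has_min_lo_plus has_max_lo_plus lo_discrete_lo_plus
        lo_discrete_lo_prod has_min_lo_prod has_max_lo_prod natLeq_ends)
  ultimately show ?case
    using alternating_order_nat_block.hyps lo_iso_Linear_order has_min_iso has_max_iso lo_discrete_iso by metis
qed

lemma alternating_order_bounded_discrete:
  assumes "alternating_order r"
  shows "Linear_order r" "has_min r" "has_max r" "lo_discrete r"
  using assms alternating_order_nat_bounded_discrete lo_iso_Linear_order has_min_iso has_max_iso lo_discrete_iso
  unfolding alternating_order_def by metis+

lemma has_min_nonempty: "has_min r \<Longrightarrow> r \<noteq> {}"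
  by (auto simp: has_min_def lo_min_def)

lemma alternating_order_nonempty: "alternating_order r \<Longrightarrow> r \<noteq> {}"
  using alternating_order_bounded_discrete(2) has_min_nonempty by metis

lemma alternating_order_one: "alternating_order {(a, a)}"
  using alternating_order_iso[OF alternating_order_nat_imp_alt[OF alternating_order_nat_one[of 0]] lo_iso_singleton] .

lemma alternating_order_plus:
  assumes "alternating_order r" "alternating_order s" shows "alternating_order (lo_plus r s)"
proof -
  obtain t u where t: "alternating_order_nat t" "t \<cong>\<^sub>l r" and u: "alternating_order_nat u" "u \<cong>\<^sub>l s"
    using assms unfolding alternating_order_def by blast
  obtain v :: "nat rel" where v: "lo_plus t u \<cong>\<^sub>l v" using countable_realisation by blast
  have "v \<cong>\<^sub>l lo_plus r s"
    using lo_iso_trans[OF lo_iso_sym[OF v] lo_plus_cong[OF t(2) u(2)]] .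
  then show ?thesis using alternating_order_nat_plus[OF t(1) u(1) v] unfolding alternating_order_def by blast
qed

lemma alternating_order_block:
  assumes "alternating_order r" "alternating_order s" shows "alternating_order (lo_plus (lo_prod natLeq r) (lo_prod (natLeq\<inverse>) s))"
proof -
  obtain t u where t: "alternating_order_nat t" "t \<cong>\<^sub>l r" and u: "alternating_order_nat u" "u \<cong>\<^sub>l s"
    using assms unfolding alternating_order_def by blast
  have lin: "Linear_order t" "Linear_order u" using t(1) u(1) alternating_order_nat_bounded_discrete by auto
  obtain v :: "nat rel" where v: "lo_plus (lo_prod natLeq t) (lo_prod (natLeq\<inverse>) u) \<cong>\<^sub>l v"
    using countable_realisation by blast
  have "v \<cong>\<^sub>l lo_plus (lo_prod natLeq r) (lo_prod (natLeq\<inverse>) s)"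
    using lo_iso_trans[OF lo_iso_sym[OF v] lo_plus_cong[OF lo_prod_cong[OF t(2) lin(1)]
        lo_prod_cong[OF u(2) lin(2)]]] .
  then show ?thesis using alternating_order_nat_block[OF t(1) u(1) v] unfolding alternating_order_def by blast
qed

text \<open>Reversal exchanges the two halves of a block and reverses their factors, so the class is
  self-dual.\<close>

lemma alternating_order_nat_converse: "alternating_order_nat r \<Longrightarrow> alternating_order (r\<inverse>)"
proof (induction rule: alternating_order_nat.induct)
  case (alternating_order_nat_one a)
  have "{(a, a)}\<inverse> = {(a, a)}" by auto
  then show ?case using alternating_order_one[of a] by simp
next
  case (alternating_order_nat_plus r s t)
  have "lo_plus (s\<inverse>) (r\<inverse>) \<cong>\<^sub>l (lo_plus r s)\<inverse>" by (rule lo_iso_sym[OF converse_lo_plus])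
  also have "\<dots> \<cong>\<^sub>l t\<inverse>" using alternating_order_nat_plus by (intro lo_iso_converse)
  finally show ?case using alternating_order_nat_plus alternating_order_plus alternating_order_iso by blast
next
  case (alternating_order_nat_block r s t)
  have "lo_plus (lo_prod natLeq (s\<inverse>)) (lo_prod (natLeq\<inverse>) (r\<inverse>)) =
      lo_plus ((lo_prod (natLeq\<inverse>) s)\<inverse>) ((lo_prod natLeq r)\<inverse>)"
    by (simp add: converse_lo_prod)
  also have "\<dots> \<cong>\<^sub>l (lo_plus (lo_prod natLeq r) (lo_prod (natLeq\<inverse>) s))\<inverse>"
    by (rule lo_iso_sym[OF converse_lo_plus])
  also have "\<dots> \<cong>\<^sub>l t\<inverse>" using alternating_order_nat_block by (intro lo_iso_converse)
  finally show ?case using alternating_order_nat_block alternating_order_block alternating_order_iso by blast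
qed

lemma alternating_order_converse: "alternating_order r \<Longrightarrow> alternating_order (r\<inverse>)"
  unfolding alternating_order_def[of r] using alternating_order_nat_converse alternating_order_iso lo_iso_converse by blast

text \<open>Admits the empty order, since the middle piece of a decomposition may be
  missing.\<close>

definition alternating_order0 :: "'a rel \<Rightarrow> bool" where
  "alternating_order0 r \<longleftrightarrow> r = {} \<or> alternating_order r"

lemma alternating_order0_iso: "alternating_order0 r \<Longrightarrow> r \<cong>\<^sub>l s \<Longrightarrow> alternating_order0 s"
  unfolding alternating_order0_def using alternating_order_iso lo_iso_empty_iff by metis

lemma alternating_order0_plus: "alternating_order0 r \<Longrightarrow> alternating_order0 s \<Longrightarrow> alternating_order0 (lo_plus r s)"
  unfolding alternating_order0_def lo_plus_eq_empty_iff
  using alternating_order_plus alternating_order_iso[OF _ lo_iso_sym[OF lo_plus_empty_left]]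
    alternating_order_iso[OF _ lo_iso_sym[OF lo_plus_empty_right]] by metis

lemma alternating_order0_converse: "alternating_order0 r \<Longrightarrow> alternating_order0 (r\<inverse>)"
  unfolding alternating_order0_def using alternating_order_converse by auto

lemma alternating_order0_ends:
  assumes "alternating_order0 r"
  shows "Linear_order r" "has_min r \<longleftrightarrow> r \<noteq> {}" "has_max r \<longleftrightarrow> r \<noteq> {}"
proof -
  have "\<not> has_min {}" "\<not> has_max {}" by (auto simp: has_min_def has_max_def lo_min_def lo_max_def)
  then show "Linear_order r" "has_min r \<longleftrightarrow> r \<noteq> {}" "has_max r \<longleftrightarrow> r \<noteq> {}"
    using assms alternating_order_bounded_discrete[of r] alternating_order_nonempty Linear_order_empty unfolding alternating_order0_def by auto
qed

text \<open>
  The order \<open>p\<close> is of the form \<open>\<omega>\<^sup>* \<times> A\<close> iff \<open>p\<inverse>\<close> is of the form \<open>\<omega> \<times> A\<close>, so \<open>ray (p\<inverse>)\<close> describes the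
  possible initial pieces of a decomposition below.
\<close>

definition ray :: "'a rel \<Rightarrow> bool" where
  "ray r \<longleftrightarrow> r = {} \<or> (\<exists>a :: nat rel. alternating_order a \<and> lo_prod natLeq a \<cong>\<^sub>l r)"

lemma ray_iso: "ray r \<Longrightarrow> r \<cong>\<^sub>l s \<Longrightarrow> ray s"
  unfolding ray_def using lo_iso_trans lo_iso_empty_iff by metis

lemma ray_empty: "ray {}"
  by (simp add: ray_def)

lemma ray_omega:
  assumes "alternating_order r" shows "ray (lo_prod natLeq r)"
proof -
  obtain t where t: "alternating_order_nat t" "t \<cong>\<^sub>l r" using assms unfolding alternating_order_def by blast
  then have "lo_prod natLeq t \<cong>\<^sub>l lo_prod natLeq r"
    using lo_prod_cong alternating_order_nat_bounded_discrete by blast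
  then show ?thesis using t alternating_order_nat_imp_alt unfolding ray_def by blast
qed

lemma ray_ends:
  assumes "ray r"
  shows "Linear_order r" "has_min r \<longleftrightarrow> r \<noteq> {}" "\<not> has_max r"
proof -
  have e: "\<not> has_min {}" "\<not> has_max {}" by (auto simp: has_min_def has_max_def lo_min_def lo_max_def)
  have "Linear_order r \<and> has_min r \<and> \<not> has_max r" if "alternating_order a" "lo_prod natLeq a \<cong>\<^sub>l r" for a :: "nat rel"
  proof -
    have "Linear_order (lo_prod natLeq a)" "has_min (lo_prod natLeq a)" "\<not> has_max (lo_prod natLeq a)"
      using alternating_order_bounded_discrete[OF that(1)] Linear_order_natLeq natLeq_ends
      by (simp_all add: Linear_order_lo_prod has_min_lo_prod has_max_lo_prod)
    then show ?thesis using lo_iso_Linear_order has_min_iso has_max_iso that by metis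
  qed
  then show "Linear_order r" "has_min r \<longleftrightarrow> r \<noteq> {}" "\<not> has_max r"
    using assms e Linear_order_empty has_min_nonempty unfolding ray_def by metis+
qed

lemma converse_ray_ends:
  assumes "ray (r\<inverse>)"
  shows "Linear_order r" "\<not> has_min r" "has_max r \<longleftrightarrow> r \<noteq> {}"
  using ray_ends[OF assms] by auto

text \<open>If \<open>p\<inverse>\<close> is \<open>\<omega> \<times> b\<close>, then
  \<open>p\<close> is \<open>\<omega>\<^sup>* \<times> b\<inverse>\<close>, and \<open>q + p\<close>
  is a block.\<close>

lemma alternating_order_ray_plus_converse_ray:
  assumes q: "ray q" "q \<noteq> {}" and p: "ray (p\<inverse>)" "p \<noteq> {}"
  shows "alternating_order (lo_plus q p)"
proof -
  obtain a :: "nat rel" where a: "alternating_order a" "lo_prod natLeq a \<cong>\<^sub>l q" using q unfolding ray_def by blast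
  obtain b :: "nat rel" where b: "alternating_order b" "lo_prod natLeq b \<cong>\<^sub>l p\<inverse>" using p unfolding ray_def by auto
  have "lo_prod (natLeq\<inverse>) (b\<inverse>) \<cong>\<^sub>l p"
    using lo_iso_converse[OF b(2)] by (simp add: converse_lo_prod)
  then show ?thesis
    using alternating_order_iso[OF alternating_order_block[OF a(1) alternating_order_converse[OF b(1)]] lo_plus_cong[OF a(2)]] by blast
qed

section \<open>Decompositions into two outer rays and a bounded middle\<close>

text \<open>The pieces are fixed on \<open>nat\<close> to keep the existential quantifiers free of
  further types; \<open>decomposableI\<close> accepts pieces on any countable carriers.\<close>

definition decomposable :: "'a rel \<Rightarrow> bool" where
  "decomposable r \<longleftrightarrow> (\<exists>(p :: nat rel) (m :: nat rel) (q :: nat rel). ray (p\<inverse>) \<and> alternating_order0 m \<and> ray q \<and> lo_plus p (lo_plus m q) \<cong>\<^sub>l r)"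

lemma decomposableI:
  fixes p :: "'b::countable rel" and m :: "'c::countable rel" and q :: "'d::countable rel"
  assumes "ray (p\<inverse>)" "alternating_order0 m" "ray q" "lo_plus p (lo_plus m q) \<cong>\<^sub>l r"
  shows "decomposable r"
proof -
  obtain p' m' q' :: "nat rel" where iso: "p \<cong>\<^sub>l p'" "m \<cong>\<^sub>l m'" "q \<cong>\<^sub>l q'"
    using countable_realisation by metis
  have "lo_plus p' (lo_plus m' q') \<cong>\<^sub>l lo_plus p (lo_plus m q)"
    by (rule lo_plus_cong[OF lo_iso_sym[OF iso(1)] lo_plus_cong[OF lo_iso_sym[OF iso(2)] lo_iso_sym[OF iso(3)]]])
  then have "lo_plus p' (lo_plus m' q') \<cong>\<^sub>l r" using assms(4) by (rule lo_iso_trans)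
  then show ?thesis
    using ray_iso[OF assms(1) lo_iso_converse[OF iso(1)]] alternating_order0_iso[OF assms(2) iso(2)]
      ray_iso[OF assms(3) iso(3)] unfolding decomposable_def by blast
qed

lemma decomposable_iso: "decomposable r \<Longrightarrow> r \<cong>\<^sub>l s \<Longrightarrow> decomposable s"
  unfolding decomposable_def using lo_iso_trans by metis

text \<open>Reversal exchanges the two outer pieces; this symmetry is the reason for asking
  \<open>ray\<close> of \<open>p\<inverse>\<close>.\<close>

lemma decomposable_converse:
  assumes "decomposable r" shows "decomposable (r\<inverse>)"
proof -
  obtain p m q :: "nat rel" where d: "ray (p\<inverse>)" "alternating_order0 m" "ray q" "lo_plus p (lo_plus m q) \<cong>\<^sub>l r"
    using assms unfolding decomposable_def by blast
  have "lo_plus (q\<inverse>) (lo_plus (m\<inverse>) (p\<inverse>)) \<cong>\<^sub>l lo_plus (lo_plus (q\<inverse>) (m\<inverse>)) (p\<inverse>)"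
    by (rule lo_iso_sym[OF lo_plus_assoc])
  also have "\<dots> \<cong>\<^sub>l lo_plus ((lo_plus m q)\<inverse>) (p\<inverse>)"
    by (intro lo_plus_cong lo_iso_refl lo_iso_sym[OF converse_lo_plus])
  also have "\<dots> \<cong>\<^sub>l (lo_plus p (lo_plus m q))\<inverse>" by (rule lo_iso_sym[OF converse_lo_plus])
  also have "\<dots> \<cong>\<^sub>l r\<inverse>" by (rule lo_iso_converse[OF d(4)])
  finally show ?thesis using d alternating_order0_converse by (intro decomposableI[of "q\<inverse>" "m\<inverse>" "p\<inverse>"]) auto
qed

text \<open>A nonempty outer piece lacks its outer endpoint, while a nonempty middle has both
  endpoints and each nonempty ray has its inner one.\<close>

lemma decomposition_ends:
  assumes "ray (p\<inverse>)" "alternating_order0 m" "ray q" and ne: "lo_plus p (lo_plus m q) \<noteq> {}"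
  shows "has_max (lo_plus p (lo_plus m q)) \<longleftrightarrow> q = {}" "has_min (lo_plus p (lo_plus m q)) \<longleftrightarrow> p = {}"
  using ne converse_ray_ends[OF assms(1)] alternating_order0_ends[OF assms(2)] ray_ends[OF assms(3)]
  unfolding lo_plus_eq_empty_iff has_max_lo_plus has_min_lo_plus by auto

text \<open>
  At the seam of two nonempty decompositions, discreteness forces \<open>q\<close> and \<open>p'\<close> to be both empty or
  both nonempty; in either case \<open>q + p'\<close> can be absorbed into the bounded middle part.
\<close>

lemma lo_plus_regroup:
  "lo_plus (lo_plus p (lo_plus m q)) (lo_plus p' (lo_plus m' q')) \<cong>\<^sub>l
   lo_plus p (lo_plus (lo_plus m (lo_plus (lo_plus q p') m')) q')"
proof -
  note sym = lo_iso_sym[OF lo_plus_assoc]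
  have "lo_plus (lo_plus p (lo_plus m q)) (lo_plus p' (lo_plus m' q')) \<cong>\<^sub>l
      lo_plus p (lo_plus (lo_plus m q) (lo_plus p' (lo_plus m' q')))" by (rule lo_plus_assoc)
  also have "\<dots> \<cong>\<^sub>l lo_plus p (lo_plus m (lo_plus q (lo_plus p' (lo_plus m' q'))))"
    by (intro lo_plus_cong lo_iso_refl lo_plus_assoc)
  also have "\<dots> \<cong>\<^sub>l lo_plus p (lo_plus m (lo_plus (lo_plus q p') (lo_plus m' q')))"
    by (intro lo_plus_cong lo_iso_refl sym)
  also have "\<dots> \<cong>\<^sub>l lo_plus p (lo_plus m (lo_plus (lo_plus (lo_plus q p') m') q'))"
    by (intro lo_plus_cong lo_iso_refl sym)
  also have "\<dots> \<cong>\<^sub>l lo_plus p (lo_plus (lo_plus m (lo_plus (lo_plus q p') m')) q')"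
    by (intro lo_plus_cong lo_iso_refl sym)
  finally show ?thesis .
qed

lemma decomposable_plus:
  assumes "decomposable r" "decomposable s" "lo_discrete (lo_plus r s)"
  shows "decomposable (lo_plus r s)"
proof -
  obtain p m q :: "nat rel" where r: "ray (p\<inverse>)" "alternating_order0 m" "ray q" "lo_plus p (lo_plus m q) \<cong>\<^sub>l r"
    using assms(1) unfolding decomposable_def by blast
  obtain p' m' q' :: "nat rel" where s: "ray (p'\<inverse>)" "alternating_order0 m'" "ray q'" "lo_plus p' (lo_plus m' q') \<cong>\<^sub>l s"
    using assms(2) unfolding decomposable_def by blast
  let ?r = "lo_plus p (lo_plus m q)" and ?s = "lo_plus p' (lo_plus m' q')"
  have iso: "lo_plus ?r ?s \<cong>\<^sub>l lo_plus r s" by (rule lo_plus_cong[OF r(4) s(4)])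
  have lin: "Linear_order ?r" "Linear_order ?s"
    using converse_ray_ends(1)[OF r(1)] alternating_order0_ends(1)[OF r(2)] ray_ends(1)[OF r(3)]
      converse_ray_ends(1)[OF s(1)] alternating_order0_ends(1)[OF s(2)] ray_ends(1)[OF s(3)]
    by (blast intro: Linear_order_lo_plus)+
  show ?thesis
  proof (cases "r = {} \<or> s = {}")
    case True
    then show ?thesis
      using decomposable_iso[OF assms(1) lo_iso_sym[OF lo_plus_empty_right]]
        decomposable_iso[OF assms(2) lo_iso_sym[OF lo_plus_empty_left]] by metis
  next
    case False
    then have ne: "?r \<noteq> {}" "?s \<noteq> {}" using lo_iso_empty_iff r(4) s(4) by metis+
    have "lo_discrete (lo_plus ?r ?s)" using lo_discrete_iso[OF lo_iso_sym[OF iso] assms(3)] .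
    then have "has_max ?r \<longleftrightarrow> has_min ?s" using ne by (simp add: lo_discrete_lo_plus[OF lin])
    then have "q = {} \<longleftrightarrow> p' = {}"
      using decomposition_ends(1)[OF r(1-3) ne(1)] decomposition_ends(2)[OF s(1-3) ne(2)] by simp
    then have "alternating_order0 (lo_plus q p')"
      using alternating_order_ray_plus_converse_ray[OF r(3) _ s(1)] unfolding alternating_order0_def lo_plus_eq_empty_iff by blast
    then have "alternating_order0 (lo_plus m (lo_plus (lo_plus q p') m'))"
      by (rule alternating_order0_plus[OF r(2) alternating_order0_plus[OF _ s(2)]])
    then show ?thesis
      by (rule decomposableI[OF r(1) _ s(3) lo_iso_trans[OF lo_iso_sym[OF lo_plus_regroup] iso]])
  qed
qed

lemma lo_plus_empty_empty: "lo_plus {} {} = {}"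
  by (simp add: lo_plus_eq_empty_iff)

lemma lo_iso_empty: "{} \<cong>\<^sub>l {}"
  by (rule lo_isoI[of undefined]) simp_all

lemma decomposable_empty: "decomposable {}"
proof (rule decomposableI)
  show "ray (({} :: nat rel)\<inverse>)" "ray ({} :: nat rel)" "alternating_order0 ({} :: nat rel)"
    by (simp_all add: ray_empty alternating_order0_def)
  show "lo_plus {} (lo_plus {} {}) \<cong>\<^sub>l {}"
    unfolding lo_plus_empty_empty by (rule lo_iso_empty)
qed

text \<open>Rotation at \<open>p + m\<close> turns \<open>\<omega> \<times> (p + m + q)\<close> into
  \<open>p + m + \<omega> \<times> (q + p + m)\<close>. The pieces \<open>p\<close> and
  \<open>m\<close> are kept, and the product is the new right-hand ray once \<open>q + p\<close> is
  known to be a block or empty.\<close>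

lemma decomposable_omega:
  assumes lin: "Linear_order r" and "decomposable r" "lo_discrete (lo_prod natLeq r)"
  shows "decomposable (lo_prod natLeq r)"
proof -
  obtain p m q :: "nat rel" where r: "ray (p\<inverse>)" "alternating_order0 m" "ray q" "lo_plus p (lo_plus m q) \<cong>\<^sub>l r"
    using assms(2) unfolding decomposable_def by blast
  let ?r = "lo_plus p (lo_plus m q)"
  have linr: "Linear_order p" "Linear_order m" "Linear_order q"
    using converse_ray_ends(1)[OF r(1)] alternating_order0_ends(1)[OF r(2)] ray_ends(1)[OF r(3)] .
  have iso: "lo_prod natLeq ?r \<cong>\<^sub>l lo_prod natLeq r"
    by (rule lo_prod_cong[OF r(4)]) (intro Linear_order_lo_plus linr)
  have ends: "has_max ?r \<longleftrightarrow> has_min ?r"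
    using assms(3) has_max_iso[OF r(4)] has_min_iso[OF r(4)] by (simp add: lo_discrete_lo_prod lin)
  show ?thesis
  proof (cases "?r = {}")
    case True
    then have "r = {}" using lo_iso_empty_iff[OF r(4)] by simp
    then show ?thesis using decomposable_empty by (simp add: lo_prod_empty)
  next
    case False
    \<comment> \<open>Discreteness of the product gives \<open>r\<close> both endpoints or neither,
      and the missing ones correspond to nonempty outer pieces.\<close>
    then have pq: "q = {} \<longleftrightarrow> p = {}" using ends decomposition_ends[OF r(1-3)] by simp
    have iso2: "lo_plus p (lo_plus m (lo_prod natLeq (lo_plus q (lo_plus p m)))) \<cong>\<^sub>l lo_prod natLeq r"
    proof -
      have "lo_plus p (lo_plus m (lo_prod natLeq (lo_plus q (lo_plus p m)))) \<cong>\<^sub>l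
        lo_plus (lo_plus p m) (lo_prod natLeq (lo_plus q (lo_plus p m)))"
        by (rule lo_iso_sym[OF lo_plus_assoc])
      also have "\<dots> \<cong>\<^sub>l lo_prod natLeq (lo_plus (lo_plus p m) q)"
        by (intro lo_iso_sym[OF omega_rotate] Linear_order_lo_plus linr)
      also have "\<dots> \<cong>\<^sub>l lo_prod natLeq ?r"
        by (intro lo_prod_cong lo_plus_assoc Linear_order_lo_plus linr)
      also note iso
      finally show ?thesis .
    qed
    have "alternating_order0 (lo_plus q p)"
      using pq alternating_order_ray_plus_converse_ray[OF r(3) _ r(1)] unfolding alternating_order0_def lo_plus_eq_empty_iff by blast
    then have "alternating_order0 (lo_plus q (lo_plus p m))"
      using alternating_order0_iso[OF alternating_order0_plus[OF _ r(2)] lo_plus_assoc] by blast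
    then have "alternating_order (lo_plus q (lo_plus p m))"
      using False unfolding alternating_order0_def lo_plus_eq_empty_iff by blast
    note omega = ray_omega[OF this]
    show ?thesis by (rule decomposableI[OF r(1,2) omega iso2])
  qed
qed

text \<open>Discreteness passes to summands and factors, so the induction hypotheses apply.
  Boundedness does not, hence the induction over all discrete orders.\<close>

lemma decomposable_finitely_presented:
  "finitely_presented r \<Longrightarrow> lo_discrete r \<Longrightarrow> decomposable r"
proof (induction rule: finitely_presented.induct)
  case (fp_iso r t)
  then show ?case using decomposable_iso lo_discrete_iso lo_iso_sym by metis
next
  case fp_zero
  show ?case by (rule decomposable_empty)
next
  case (fp_one a)
  have "lo_plus {} (lo_plus {(0::nat, 0)} {}) \<cong>\<^sub>l {(a, a)}"
    using lo_iso_trans[OF lo_plus_empty_left lo_iso_trans[OF lo_plus_empty_right lo_iso_singleton]] .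
  then show ?case
    by (intro decomposableI[of "{} :: nat rel" "{(0::nat, 0)}" "{} :: nat rel"])
      (auto simp: ray_empty alternating_order0_def alternating_order_one)
next
  case (fp_plus r s t)
  have lin: "Linear_order r" "Linear_order s"
    using fp_plus.hyps finitely_presented_Linear_order by blast+
  have d: "lo_discrete (lo_plus r s)" using fp_plus lo_discrete_iso lo_iso_sym by blast
  then have "decomposable (lo_plus r s)"
    using fp_plus.IH decomposable_plus lo_discrete_lo_plus[OF lin] by blast
  then show ?case using fp_plus.hyps decomposable_iso by blast
next
  case (fp_omega r t)
  have lin: "Linear_order r"
    using fp_omega.hyps finitely_presented_Linear_order by blast
  have d: "lo_discrete (lo_prod natLeq r)" using fp_omega lo_discrete_iso lo_iso_sym by blast
  then have "decomposable (lo_prod natLeq r)"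
    using fp_omega.IH decomposable_omega[OF lin] by (simp add: lo_discrete_lo_prod[OF lin])
  then show ?case using fp_omega.hyps decomposable_iso by blast
next
  case (fp_omega_star r t)
  have lin: "Linear_order r"
    using fp_omega_star.hyps finitely_presented_Linear_order by blast
  \<comment> \<open>The \<open>\<omega>\<^sup>*\<close> case is the \<open>\<omega>\<close> case for
    \<open>r\<inverse>\<close>, reversed.\<close>
  have eq: "lo_prod (natLeq\<inverse>) r = (lo_prod natLeq (r\<inverse>))\<inverse>" by (simp add: converse_lo_prod)
  have d: "lo_discrete (lo_prod (natLeq\<inverse>) r)" using fp_omega_star lo_discrete_iso lo_iso_sym by blast
  then have "decomposable (r\<inverse>)"
    using fp_omega_star.IH decomposable_converse by (simp add: lo_discrete_lo_prod[OF lin])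
  moreover have "lo_discrete (lo_prod natLeq (r\<inverse>))" using d unfolding eq lo_discrete_converse .
  ultimately have "decomposable (lo_prod natLeq (r\<inverse>))"
    using decomposable_omega Linear_order_converse[OF lin] by blast
  then have "decomposable (lo_prod (natLeq\<inverse>) r)" unfolding eq by (rule decomposable_converse)
  then show ?case using fp_omega_star.hyps decomposable_iso by blast
qed

lemma bounded_discrete_imp_alternating_order:
  assumes "finitely_presented r" "lo_bounded r" "lo_discrete r"
  shows "alternating_order r"
proof -
  obtain p m q :: "nat rel" where r: "ray (p\<inverse>)" "alternating_order0 m" "ray q" "lo_plus p (lo_plus m q) \<cong>\<^sub>l r"
    using decomposable_finitely_presented[OF assms(1,3)] unfolding decomposable_def by blast
  let ?r = "lo_plus p (lo_plus m q)"
  have ends: "has_min ?r" "has_max ?r"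
    using assms(2) has_max_iso[OF r(4)] has_min_iso[OF r(4)] by (simp_all add: lo_bounded_iff)
  then have ne: "?r \<noteq> {}" using has_min_nonempty by blast
  then have pq: "p = {}" "q = {}" using ends decomposition_ends[OF r(1-3)] by simp_all
  have "alternating_order m" using pq ne r(2) unfolding alternating_order0_def lo_plus_eq_empty_iff by blast
  have iso: "m \<cong>\<^sub>l ?r"
    unfolding pq by (rule lo_iso_sym[OF lo_iso_trans[OF lo_plus_empty_left lo_plus_empty_right]])
  show ?thesis by (rule alternating_order_iso[OF alternating_order_iso[OF \<open>alternating_order m\<close> iso] r(4)])
qed

section \<open>Orders of alternating trees\<close>

text \<open>The order of a node before multiplication by its own sign factor. The node-by-node
  arguments concern this part, because alternation at a node constrains the signs of its
  children.\<close>

definition body :: "nat list set \<Rightarrow> (nat list \<Rightarrow> sign) \<Rightarrow> nat list \<Rightarrow> (nat \<times> nat list) rel" where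
  "body T s \<sigma> = lo_sum (nat_seg (width T \<sigma>)) (\<lambda>x. LIN_at T s (\<sigma> @ [x]))"

lemma LIN_at_eq:
  "finite T \<Longrightarrow> \<sigma> \<in> T \<Longrightarrow> LIN_at T s \<sigma> =
     map_prod encode encode ` lo_prod (omega_sign (s \<sigma>))
       (if width T \<sigma> = 0 then {((0, []), (0, []))} else body T s \<sigma>)"
  unfolding body_def nat_seg_def by (subst LIN_at.simps) simp

lemma LIN_at_outside: "\<not> (finite T \<and> \<sigma> \<in> T) \<Longrightarrow> LIN_at T s \<sigma> = {}"
  by (subst LIN_at.simps) (erule if_not_P)

lemma LIN_at_iso:
  assumes "finite T" "\<sigma> \<in> T"
  shows "LIN_at T s \<sigma> \<cong>\<^sub>l lo_prod (omega_sign (s \<sigma>))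
       (if width T \<sigma> = 0 then {((0, []), (0, []))} else body T s \<sigma>)"
proof -
  have "inj_on encode S" for S by (auto simp: inj_on_def)
  then show ?thesis unfolding LIN_at_eq[OF assms] by (intro lo_iso_sym[OF lo_iso_image])
qed

lemma Linear_order_omega_sign: "Linear_order (omega_sign g)"
  by (cases g) (simp_all only: omega_sign.simps Linear_order_natLeq Linear_order_singleton)

lemma Linear_order_LIN_at: "Linear_order (LIN_at T s \<sigma>)"
proof (induction T s \<sigma> rule: LIN_at.induct)
  case (1 T s \<sigma>)
  show ?case
  proof (cases "finite T \<and> \<sigma> \<in> T")
    case False
    show ?thesis unfolding LIN_at_outside[OF False] by (rule Linear_order_empty)
  next
    case True
    have "Linear_order (body T s \<sigma>)" if "width T \<sigma> \<noteq> 0"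
      unfolding body_def using 1 True that by (intro Linear_order_lo_sum Linear_order_nat_seg) blast
    then have "Linear_order (lo_prod (omega_sign (s \<sigma>))
       (if width T \<sigma> = 0 then {((0, []), (0, []))} else body T s \<sigma>))"
      by (intro Linear_order_lo_prod Linear_order_omega_sign) (simp only: Linear_order_singleton split: if_split, blast)
    then show ?thesis using lo_iso_Linear_order[OF _ lo_iso_sym[OF LIN_at_iso]] True by blast
  qed
qed

lemma Linear_order_body: "Linear_order (body T s \<sigma>)"
  unfolding body_def by (intro Linear_order_lo_sum Linear_order_nat_seg Linear_order_LIN_at)

section \<open>From alternating trees to alternating orders\<close>

lemma alternating_order_nat_seg: "n \<noteq> 0 \<Longrightarrow> alternating_order (nat_seg n)"
proof (induction n)
  case (Suc n)
  have 1: "nat_seg 1 = {(0, 0)}" by (auto simp: nat_seg_def)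
  show ?case
  proof (cases "n = 0")
    case True
    then show ?thesis using alternating_order_one[of 0] 1 by simp
  next
    case False
    then have "alternating_order (lo_plus (nat_seg n) (nat_seg 1))" using Suc alternating_order_plus alternating_order_one 1 by metis
    then show ?thesis using alternating_order_iso[OF _ lo_iso_sym[OF nat_seg_add]] by fastforce
  qed
qed simp

lemma lo_sum_singletons:
  assumes "\<And>x. x \<in> Field A \<Longrightarrow> B x \<cong>\<^sub>l {(0::nat, 0)}" "Linear_order A"
  shows "lo_sum A B \<cong>\<^sub>l A"
proof -
  have "Linear_order (B x)" if "x \<in> Field A" for x
    using lo_iso_Linear_order[OF Linear_order_singleton lo_iso_sym[OF assms(1)[OF that]]] .
  then have "lo_sum A B \<cong>\<^sub>l lo_sum A (\<lambda>_. {(0::nat, 0)})" using assms(1) by (rule lo_sum_cong)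
  also have "\<dots> \<cong>\<^sub>l A" using lo_prod_singleton_right[OF assms(2)] unfolding lo_prod_def .
  finally show ?thesis .
qed

definition alt_sign :: "nat \<Rightarrow> sign" where
  "alt_sign x = (if even x then Plus else Minus)"

lemma lo_sum_two:
  assumes "Linear_order (B 0)" "Linear_order (B (Suc 0))"
  shows "lo_sum (nat_seg 2) B \<cong>\<^sub>l lo_plus (B 0) (B (Suc 0))"
proof -
  have "lo_sum (nat_seg 2) B \<cong>\<^sub>l lo_sum (nat_seg (1 + 1)) (\<lambda>x. if x < 1 then B x else B (Suc (x - 1)))"
    using assms by (simp add: numeral_2_eq_2)
      (rule lo_sum_cong; auto simp: Field_nat_seg less_Suc_eq intro!: lo_iso_refl)
  also have "\<dots> \<cong>\<^sub>l lo_plus (lo_sum (nat_seg 1) B) (lo_sum (nat_seg 1) (\<lambda>x. B (Suc x)))"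
    using assms by (intro lo_sum_nat_seg_add) auto
  also have "\<dots> \<cong>\<^sub>l lo_plus (B 0) (B (Suc 0))"
    using assms by (intro lo_plus_cong lo_sum_nat_seg_1)
  finally show ?thesis .
qed

lemma eq_lo_iso_trans: "r = s \<Longrightarrow> s \<cong>\<^sub>l t \<Longrightarrow> r \<cong>\<^sub>l t"
  by simp

lemma lo_sum_eq_cong: "(\<And>a. a \<in> Field A \<Longrightarrow> B a = C a) \<Longrightarrow> lo_sum A B = lo_sum A C"
  by (auto simp: lo_sum_def)

text \<open>Consecutive summands are paired into blocks \<open>\<omega> \<times> f (2 * n) +
  \<omega>\<^sup>* \<times> f (Suc (2 * n))\<close>, which are then added up.\<close>

lemma alternating_order_alternating_sum:
  assumes "\<And>x. x < 2 * n \<Longrightarrow> alternating_order (f x)" "n \<noteq> 0"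
  shows "alternating_order (lo_sum (nat_seg (2 * n)) (\<lambda>x. lo_prod (omega_sign (alt_sign x)) (f x)))"
  using assms
proof (induction n)
  case (Suc n)
  let ?B = "\<lambda>x. lo_prod (omega_sign (alt_sign x)) (f x)"
  let ?C = "\<lambda>x. ?B (x + 2 * n)"
  have lin: "Linear_order (?B x)" if "x < 2 * Suc n" for x
    using alternating_order_bounded_discrete(1)[OF Suc.prems(1)[OF that]]
    by (intro Linear_order_lo_prod Linear_order_omega_sign)
  have "alternating_order (lo_plus (lo_prod natLeq (f (2 * n))) (lo_prod (natLeq\<inverse>) (f (Suc (2 * n)))))"
    using Suc.prems(1) by (intro alternating_order_block) auto
  then have "alternating_order (lo_plus (?C 0) (?C (Suc 0)))" by (simp add: alt_sign_def)
  moreover have "lo_sum (nat_seg 2) ?C \<cong>\<^sub>l lo_plus (?C 0) (?C (Suc 0))"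
    by (intro lo_sum_two lin) auto
  ultimately have C: "alternating_order (lo_sum (nat_seg 2) ?C)" by (blast intro: alternating_order_iso lo_iso_sym)
  show ?case
  proof (cases "n = 0")
    case True
    then show ?thesis using C by (simp add: numeral_2_eq_2)
  next
    case False
    then have B: "alternating_order (lo_sum (nat_seg (2 * n)) ?B)" using Suc by simp
    have split: "lo_sum (nat_seg (2 * n + 2)) ?B \<cong>\<^sub>l lo_plus (lo_sum (nat_seg (2 * n)) ?B) (lo_sum (nat_seg 2) ?C)"
    proof (rule eq_lo_iso_trans)
      show "lo_sum (nat_seg (2 * n + 2)) ?B = lo_sum (nat_seg (2 * n + 2)) (\<lambda>x. if x < 2 * n then ?B x else ?C (x - 2 * n))"
        by (rule lo_sum_eq_cong) simp
      show "lo_sum (nat_seg (2 * n + 2)) (\<lambda>x. if x < 2 * n then ?B x else ?C (x - 2 * n)) \<cong>\<^sub>l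
          lo_plus (lo_sum (nat_seg (2 * n)) ?B) (lo_sum (nat_seg 2) ?C)"
        by (intro lo_sum_nat_seg_add lin) simp_all
    qed
    have "2 * Suc n = 2 * n + 2" by simp
    then show ?thesis
      by (simp only:) (rule alternating_order_iso[OF alternating_order_plus[OF B C] lo_iso_sym[OF split]])
  qed
qed simp

lemma finite_children: "finite T \<Longrightarrow> finite {x. \<sigma> @ [x] \<in> T}"
  using finite_vimageI[of T "\<lambda>x. \<sigma> @ [x]"] by (simp add: inj_def vimage_def)

lemma leaf_iff_width: "finite T \<Longrightarrow> \<sigma> \<in> T \<Longrightarrow> is_leaf T \<sigma> \<longleftrightarrow> width T \<sigma> = 0"
  using finite_children[of T \<sigma>] by (simp add: is_leaf_def width_def)

text \<open>A leaf contributes one point: its empty sum is \<open>\<one>\<close> by convention, and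
  its sign factor is \<open>\<one>\<close> as well.\<close>

lemma body_leaves:
  assumes fin: "finite T"
    and leaves: "\<And>x. x < width T \<sigma> \<Longrightarrow> is_leaf T (\<sigma> @ [x]) \<and> s (\<sigma> @ [x]) = Zero"
  shows "body T s \<sigma> \<cong>\<^sub>l nat_seg (width T \<sigma>)"
proof -
  have "LIN_at T s (\<sigma> @ [x]) \<cong>\<^sub>l {(0::nat, 0)}" if "x < width T \<sigma>" for x
  proof -
    have child: "\<sigma> @ [x] \<in> T" using leaves[OF that] by (simp add: is_leaf_def)
    then have "width T (\<sigma> @ [x]) = 0" using leaves[OF that] leaf_iff_width[OF fin] by blast
    then have "LIN_at T s (\<sigma> @ [x]) \<cong>\<^sub>l lo_prod {(0 :: nat, 0)} {((0 :: nat, [] :: nat list), (0, []))}"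
      using LIN_at_iso[OF fin child, of s] leaves[OF that] by simp
    also have "\<dots> \<cong>\<^sub>l {((0 :: nat, [] :: nat list), (0, []))}"
      by (rule lo_prod_singleton_left[OF Linear_order_singleton])
    also have "\<dots> \<cong>\<^sub>l {(0::nat, 0)}" by (rule lo_iso_singleton)
    finally show ?thesis .
  qed
  then show ?thesis
    unfolding body_def by (intro lo_sum_singletons Linear_order_nat_seg) (simp add: Field_nat_seg)
qed

lemma body_blocks:
  assumes fin: "finite T"
    and child: "\<And>x. x < width T \<sigma> \<Longrightarrow> \<sigma> @ [x] \<in> T"
    and blocks: "\<And>x. x < width T \<sigma> \<Longrightarrow> \<not> is_leaf T (\<sigma> @ [x]) \<and> s (\<sigma> @ [x]) = alt_sign x"
  shows "body T s \<sigma> \<cong>\<^sub>l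
    lo_sum (nat_seg (width T \<sigma>)) (\<lambda>x. lo_prod (omega_sign (alt_sign x)) (body T s (\<sigma> @ [x])))"
  unfolding body_def[of T s \<sigma>]
proof (intro lo_sum_cong Linear_order_LIN_at)
  fix x assume "x \<in> Field (nat_seg (width T \<sigma>))"
  then have x: "x < width T \<sigma>" by (simp add: Field_nat_seg)
  have "width T (\<sigma> @ [x]) \<noteq> 0" using blocks[OF x] leaf_iff_width[OF fin child[OF x]] by simp
  then show "LIN_at T s (\<sigma> @ [x]) \<cong>\<^sub>l lo_prod (omega_sign (alt_sign x)) (body T s (\<sigma> @ [x]))"
    using LIN_at_iso[OF fin child[OF x], of s] blocks[OF x] by simp
qed

text \<open>Induction on the number of nodes at least as long as the current one, the measure from
  the termination proof of \<open>LIN_at\<close>. All-zero children give a finite order, alternating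
  children an alternating sum of smaller bodies.\<close>

lemma alternating_order_body:
  assumes tree: "signed_tree3 T s" and alternating: "alternating T s"
  shows "\<sigma> \<in> T \<Longrightarrow> \<not> is_leaf T \<sigma> \<Longrightarrow> alternating_order (body T s \<sigma>)"
proof -
  have fin: "finite T" and lab: "standard_labelling T"
    and zero: "\<And>\<sigma>. \<sigma> \<in> T \<Longrightarrow> s \<sigma> = Zero \<longleftrightarrow> \<sigma> = [] \<or> is_leaf T \<sigma>"
    using tree by (auto simp: signed_tree3_def is_tree_def)
  show "\<sigma> \<in> T \<Longrightarrow> \<not> is_leaf T \<sigma> \<Longrightarrow> alternating_order (body T s \<sigma>)"
  proof (induction "card {\<tau> \<in> T. length \<sigma> \<le> length \<tau>}" arbitrary: \<sigma> rule: less_induct)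
    case less
    let ?w = "width T \<sigma>"
    have child: "\<sigma> @ [x] \<in> T" if "x < ?w" for x
      using lab less.prems(1) that by (auto simp: standard_labelling_def)
    have w: "?w \<noteq> 0" using less.prems leaf_iff_width[OF fin] by blast
    have IH: "alternating_order (body T s (\<sigma> @ [x]))" if "x < ?w" "\<not> is_leaf T (\<sigma> @ [x])" for x
    proof (rule less.hyps)
      have "\<sigma> \<in> {\<tau> \<in> T. length \<sigma> \<le> length \<tau>} - {\<tau> \<in> T. length (\<sigma> @ [x]) \<le> length \<tau>}"
        using less.prems by simp
      then have "{\<tau> \<in> T. length (\<sigma> @ [x]) \<le> length \<tau>} \<subset> {\<tau> \<in> T. length \<sigma> \<le> length \<tau>}"
        by fastforce
      then show "card {\<tau> \<in> T. length (\<sigma> @ [x]) \<le> length \<tau>} < card {\<tau> \<in> T. length \<sigma> \<le> length \<tau>}"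
        using fin by (intro psubset_card_mono) auto
    qed (use child that in auto)
    consider (a) "\<forall>x<?w. s (\<sigma> @ [x]) = Zero" | (b) "even ?w" "\<forall>x<?w. s (\<sigma> @ [x]) = alt_sign x"
      using alternating less.prems unfolding alternating_def alt_sign_def by blast
    then show ?case
    proof cases
      case a
      \<comment> \<open>A child is never the root, so its sign is \<open>Zero\<close> exactly if it
        is a leaf; the same fact excludes leaves in case \<open>b\<close>.\<close>
      have "body T s \<sigma> \<cong>\<^sub>l nat_seg ?w"
        by (rule body_leaves[OF fin]) (use a zero[OF child] in auto)
      then show ?thesis using alternating_order_iso[OF alternating_order_nat_seg[OF w]] lo_iso_sym by blast
    next
      case b
      have nl: "\<not> is_leaf T (\<sigma> @ [x])" if "x < ?w" for x
        using zero[OF child[OF that]] b(2) that by (auto simp: alt_sign_def split: if_splits)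
      let ?f = "\<lambda>x. body T s (\<sigma> @ [x])"
      have "body T s \<sigma> \<cong>\<^sub>l lo_sum (nat_seg ?w) (\<lambda>x. lo_prod (omega_sign (alt_sign x)) (?f x))"
        by (rule body_blocks[OF fin child]) (use b(2) nl in auto)
      moreover obtain n where n: "?w = 2 * n" using b(1) by blast
      have "alternating_order (lo_sum (nat_seg ?w) (\<lambda>x. lo_prod (omega_sign (alt_sign x)) (?f x)))"
        unfolding n using IH nl w by (intro alternating_order_alternating_sum) (auto simp: n)
      ultimately show ?thesis using alternating_order_iso lo_iso_sym by blast
    qed
  qed
qed

lemma root_in_tree: "is_tree T \<Longrightarrow> [] \<in> T"
  by (auto simp: is_tree_def)

text \<open>The root has sign \<open>Zero\<close>, so its factor is a single point and
  disappears.\<close>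

lemma LIN_iso_body:
  assumes "is_tree T" "s [] = Zero" "\<not> is_leaf T []"
  shows "LIN T s \<cong>\<^sub>l body T s []"
proof -
  have fin: "finite T" and root: "[] \<in> T" using assms root_in_tree by (auto simp: is_tree_def)
  have "card T \<noteq> 1"
  proof
    assume "card T = 1"
    then obtain \<tau> where "T = {\<tau>}" by (auto simp: card_1_singleton_iff)
    then show False using root assms(3) by (auto simp: is_leaf_def)
  qed
  then have "LIN T s = LIN_at T s []" by (simp add: LIN_def)
  also have "\<dots> \<cong>\<^sub>l lo_prod {(0 :: nat, 0)} (body T s [])"
    using LIN_at_iso[OF fin root, of s] assms leaf_iff_width[OF fin root] by simp
  also have "\<dots> \<cong>\<^sub>l body T s []" by (rule lo_prod_singleton_left[OF Linear_order_body])
  finally show ?thesis .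
qed

lemma LIN_empty_or_alternating_order:
  assumes "signed_tree3 T s" "alternating T s"
  shows "LIN T s = {} \<or> alternating_order (LIN T s)"
proof (cases "is_leaf T []")
  case True
  \<comment> \<open>Any further node would have a prefix of length one, which would be a child of
    the root.\<close>
  have "T = {[]}"
  proof -
    have "\<tau> = []" if "\<tau> \<in> T" for \<tau>
    proof (rule ccontr)
      assume "\<tau> \<noteq> []"
      then have "prefix [hd \<tau>] \<tau>" by (cases \<tau>) auto
      then have "[hd \<tau>] \<in> T" using assms(1) that by (auto simp: signed_tree3_def is_tree_def)
      then show False using True by (auto simp: is_leaf_def)
    qed
    then show ?thesis using True by (auto simp: is_leaf_def)
  qed
  then show ?thesis by (simp add: LIN_def)
next
  case False
  have tree: "is_tree T" "s [] = Zero" "[] \<in> T"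
    using assms(1) root_in_tree by (auto simp: signed_tree3_def)
  show ?thesis
    using alternating_order_iso[OF alternating_order_body[OF assms tree(3) False] lo_iso_sym[OF LIN_iso_body[of T s, OF tree(1,2) False]]] ..
qed

section \<open>Trees for alternating orders\<close>

definition child :: "nat list set \<Rightarrow> nat \<Rightarrow> nat list set" where
  "child T x = {\<tau>. x # \<tau> \<in> T}"

lemma finite_child: "finite T \<Longrightarrow> finite (child T x)"
  unfolding child_def using finite_vimageI[of T "Cons x"] by (simp add: vimage_def)

lemma width_child: "width (child T x) \<sigma> = width T (x # \<sigma>)"
  by (simp add: width_def child_def)

lemma is_leaf_child: "is_leaf (child T x) \<sigma> \<longleftrightarrow> is_leaf T (x # \<sigma>)"
  by (simp add: is_leaf_def child_def)

text \<open>The encoding records only choices made from the node downwards and not the position of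
  the node, so moving to the subtree gives an equality of relations.\<close>

lemma LIN_at_child:
  assumes "finite T"
  shows "LIN_at T s (x # \<sigma>) = LIN_at (child T x) (\<lambda>\<tau>. s (x # \<tau>)) \<sigma>"
proof (induction "child T x" "\<lambda>\<tau>. s (x # \<tau>)" \<sigma> rule: LIN_at.induct)
  case (1 \<sigma>)
  show ?case
  proof (cases "x # \<sigma> \<in> T")
    case False
    then show ?thesis by (simp add: LIN_at_outside child_def)
  next
    case True
    then have \<sigma>: "\<sigma> \<in> child T x" by (simp add: child_def)
    have "body T s (x # \<sigma>) = body (child T x) (\<lambda>\<tau>. s (x # \<tau>)) \<sigma>" if "width (child T x) \<sigma> \<noteq> 0"
      unfolding body_def width_child
      by (rule lo_sum_eq_cong) (use 1 \<sigma> that finite_child[OF assms] in simp)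
    then show ?thesis
      by (simp add: LIN_at_eq[OF assms True] LIN_at_eq[OF finite_child[OF assms] \<sigma>] width_child)
  qed
qed

lemma body_child:
  assumes "finite T"
  shows "body T s (x # \<sigma>) = body (child T x) (\<lambda>\<tau>. s (x # \<tau>)) \<sigma>"
  unfolding body_def width_child by (simp add: LIN_at_child[OF assms])

text \<open>\<open>body\<close> depends only on signs strictly below its node. This is needed
  because the root of a tree has sign \<open>Zero\<close>, but becomes a node with an alternating
  sign after grafting.\<close>

lemma body_root_cong:
  assumes "finite T" "\<And>y \<tau>. s (y # \<tau>) = s' (y # \<tau>)"
  shows "body T s [] = body T s' []"
  unfolding body_def by (simp add: LIN_at_child[OF assms(1)] assms(2))

section \<open>Trees without signs\<close>

text \<open>These are the signs forced by alternation: an inner node below the root takes its sign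
  from the parity of its position among its siblings. Hence it suffices to construct unsigned
  trees.\<close>

definition canonical_sign :: "nat list set \<Rightarrow> nat list \<Rightarrow> sign" where
  "canonical_sign T \<sigma> = (if \<sigma> = [] \<or> is_leaf T \<sigma> then Zero else alt_sign (last \<sigma>))"

text \<open>Alternation expressed through leaves alone. A leaf satisfies both alternatives
  vacuously, so the disjunction is not exclusive.\<close>

definition alternating_shape :: "nat list set \<Rightarrow> bool" where
  "alternating_shape T \<longleftrightarrow> is_tree T \<and> standard_labelling T \<and>
     (\<forall>\<sigma>\<in>T. (\<forall>x<width T \<sigma>. is_leaf T (\<sigma> @ [x])) \<or>
        even (width T \<sigma>) \<and> (\<forall>x<width T \<sigma>. \<not> is_leaf T (\<sigma> @ [x])))"

lemma alternating_shape_canonical_sign: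
  assumes "alternating_shape T"
  shows "signed_tree3 T (canonical_sign T)" "alternating T (canonical_sign T)"
proof -
  have nz: "alt_sign x \<noteq> Zero" for x by (simp add: alt_sign_def)
  show "signed_tree3 T (canonical_sign T)"
    using assms nz by (auto simp: alternating_shape_def signed_tree3_def canonical_sign_def)
  have fin: "finite T" using assms by (simp add: alternating_shape_def is_tree_def)
  have sgn: "canonical_sign T (\<sigma> @ [x]) = (if is_leaf T (\<sigma> @ [x]) then Zero else alt_sign x)" for \<sigma> x
    by (simp add: canonical_sign_def)
  show "alternating T (canonical_sign T)"
    unfolding alternating_def alt_sign_def[symmetric]
  proof (intro ballI impI)
    fix \<sigma> assume \<sigma>: "\<sigma> \<in> T" "\<not> is_leaf T \<sigma>"
    \<comment> \<open>With at least one child the two alternatives exclude each other, as the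
      exclusive disjunction in \<open>alternating\<close> demands.\<close>
    then have w: "0 < width T \<sigma>" using leaf_iff_width[OF fin] by blast
    have "(\<forall>x<width T \<sigma>. is_leaf T (\<sigma> @ [x])) \<or>
        even (width T \<sigma>) \<and> (\<forall>x<width T \<sigma>. \<not> is_leaf T (\<sigma> @ [x]))"
      using assms \<sigma>(1) by (simp add: alternating_shape_def)
    then show "(\<forall>x<width T \<sigma>. canonical_sign T (\<sigma> @ [x]) = Zero) \<noteq>
      (even (width T \<sigma>) \<and> (\<forall>x<width T \<sigma>. canonical_sign T (\<sigma> @ [x]) = alt_sign x))"
    proof
      assume "\<forall>x<width T \<sigma>. is_leaf T (\<sigma> @ [x])"
      then show ?thesis using w by (auto simp: sgn dest: nz[THEN not_sym, THEN notE])
    next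
      assume "even (width T \<sigma>) \<and> (\<forall>x<width T \<sigma>. \<not> is_leaf T (\<sigma> @ [x]))"
      then show ?thesis using w by (auto simp: sgn nz)
    qed
  qed
qed

section \<open>Grafting trees below a new root\<close>

definition graft :: "nat \<Rightarrow> (nat \<Rightarrow> nat list set) \<Rightarrow> nat list set" where
  "graft n Ts = insert [] (\<Union>x<n. (#) x ` Ts x)"

lemma Nil_in_graft [simp]: "[] \<in> graft n Ts" by (simp add: graft_def)

lemma Cons_in_graft [simp]: "x # \<tau> \<in> graft n Ts \<longleftrightarrow> x < n \<and> \<tau> \<in> Ts x"
  by (auto simp: graft_def)

lemma child_graft: "x < n \<Longrightarrow> child (graft n Ts) x = Ts x"
  by (simp add: child_def)

lemma width_graft_Cons: "x < n \<Longrightarrow> width (graft n Ts) (x # \<sigma>) = width (Ts x) \<sigma>"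
  by (simp add: child_graft flip: width_child)

lemma is_leaf_graft_Cons: "x < n \<Longrightarrow> is_leaf (graft n Ts) (x # \<sigma>) \<longleftrightarrow> is_leaf (Ts x) \<sigma>"
  by (simp add: child_graft flip: is_leaf_child)

lemma width_graft_Nil: "(\<And>x. x < n \<Longrightarrow> is_tree (Ts x)) \<Longrightarrow> width (graft n Ts) [] = n"
proof -
  assume "\<And>x. x < n \<Longrightarrow> is_tree (Ts x)"
  then have "{x. [] @ [x] \<in> graft n Ts} = {..<n}" by (auto simp: root_in_tree)
  then show ?thesis by (simp add: width_def)
qed

lemma is_tree_graft:
  assumes "\<And>x. x < n \<Longrightarrow> is_tree (Ts x)" shows "is_tree (graft n Ts)"
  unfolding is_tree_def
proof (intro conjI ballI allI impI)
  show "finite (graft n Ts)" using assms by (auto simp: graft_def is_tree_def)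
  fix \<tau> \<sigma> assume \<tau>: "\<tau> \<in> graft n Ts" "prefix \<sigma> \<tau>"
  show "\<sigma> \<in> graft n Ts"
  proof (cases \<sigma>)
    case (Cons x \<sigma>')
    then obtain \<tau>' where \<tau>': "\<tau> = x # \<tau>'" "prefix \<sigma>' \<tau>'" using \<tau>(2) by (cases \<tau>) auto
    then have "x < n" "\<tau>' \<in> Ts x" using \<tau>(1) by auto
    then have "\<sigma>' \<in> Ts x" using assms[of x] \<tau>'(2) unfolding is_tree_def by blast
    then show ?thesis using Cons \<open>x < n\<close> by simp
  qed simp
qed (use Nil_in_graft in blast)

text \<open>Only the new root brings a new condition, stated as \<open>kids\<close>; every other
  node inherits its condition from its own tree.\<close>

lemma alternating_shape_graft:
  assumes sh: "\<And>x. x < n \<Longrightarrow> alternating_shape (Ts x)"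
    and kids: "(\<forall>x<n. is_leaf (Ts x) []) \<or> even n \<and> (\<forall>x<n. \<not> is_leaf (Ts x) [])"
  shows "alternating_shape (graft n Ts)"
proof -
  have tree: "is_tree (Ts x)" if "x < n" for x using sh[OF that] by (simp add: alternating_shape_def)
  note root = width_graft_Nil[OF tree]
  show ?thesis unfolding alternating_shape_def
  proof (intro conjI ballI)
    show "is_tree (graft n Ts)" using is_tree_graft[OF tree] .
    show "standard_labelling (graft n Ts)"
      unfolding standard_labelling_def
    proof (intro ballI allI)
      fix \<sigma> x assume "\<sigma> \<in> graft n Ts"
      then show "\<sigma> @ [x] \<in> graft n Ts \<longleftrightarrow> x < width (graft n Ts) \<sigma>"
        using sh tree
        by (cases \<sigma>) (auto simp: root root_in_tree width_graft_Cons alternating_shape_def standard_labelling_def)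
    qed
    fix \<sigma> assume \<sigma>: "\<sigma> \<in> graft n Ts"
    show "(\<forall>x<width (graft n Ts) \<sigma>. is_leaf (graft n Ts) (\<sigma> @ [x])) \<or>
        even (width (graft n Ts) \<sigma>) \<and> (\<forall>x<width (graft n Ts) \<sigma>. \<not> is_leaf (graft n Ts) (\<sigma> @ [x]))"
    proof (cases \<sigma>)
      case Nil
      then show ?thesis using kids by (simp add: root is_leaf_graft_Cons)
    next
      case (Cons y \<tau>)
      then have y: "y < n" "\<tau> \<in> Ts y" using \<sigma> by auto
      then show ?thesis using sh[OF y(1)]
        by (simp add: Cons alternating_shape_def width_graft_Cons is_leaf_graft_Cons)
    qed
  qed
qed

section \<open>Orders realised by unsigned trees\<close>

text \<open>Formulated with \<open>body\<close> so that the order can serve as a factor after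
  grafting. The root must have a child, so that it then becomes an inner node with a nonzero
  sign.\<close>

definition tree_order :: "'a rel \<Rightarrow> bool" where
  "tree_order r \<longleftrightarrow> (\<exists>T. alternating_shape T \<and> \<not> is_leaf T [] \<and> body T (canonical_sign T) [] \<cong>\<^sub>l r)"

lemma tree_order_Linear_order: "tree_order r \<Longrightarrow> Linear_order r"
  unfolding tree_order_def using lo_iso_Linear_order[OF Linear_order_body] by blast

lemma tree_order_iso: "tree_order r \<Longrightarrow> r \<cong>\<^sub>l s \<Longrightarrow> tree_order s"
  unfolding tree_order_def using lo_iso_trans by metis

lemma tree_order_LIN:
  assumes "tree_order r"
  shows "\<exists>T s. signed_tree3 T s \<and> alternating T s \<and> LIN T s \<cong>\<^sub>l r"
proof -
  obtain T where T: "alternating_shape T" "\<not> is_leaf T []" "body T (canonical_sign T) [] \<cong>\<^sub>l r"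
    using assms unfolding tree_order_def by blast
  have "is_tree T" using T(1) by (simp add: alternating_shape_def)
  moreover have "canonical_sign T [] = Zero" by (simp add: canonical_sign_def)
  ultimately have "LIN T (canonical_sign T) \<cong>\<^sub>l r"
    using lo_iso_trans[OF LIN_iso_body[of T "canonical_sign T"] T(3)] T(2) by blast
  then show ?thesis using alternating_shape_canonical_sign[OF T(1)] by blast
qed

lemma tree_order_nat_seg:
  assumes "n \<noteq> 0" shows "tree_order (nat_seg n)"
proof -
  let ?T = "graft n (\<lambda>_. {[]})"
  have leaf: "is_leaf {[]} []" by (simp add: is_leaf_def)
  have tree: "is_tree {[]}" by (simp add: is_tree_def)
  have "width {[]} [] = 0" by (simp add: width_def)
  then have sh: "alternating_shape {[]}"
    using tree by (simp add: alternating_shape_def standard_labelling_def)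
  have w: "width ?T [] = n" by (rule width_graft_Nil) (rule tree)
  have "body ?T (canonical_sign ?T) [] \<cong>\<^sub>l nat_seg (width ?T [])"
  proof (rule body_leaves)
    show "finite ?T" by (simp add: graft_def)
    fix x assume "x < width ?T []"
    then have "is_leaf ?T [x]" using w leaf by (simp add: is_leaf_graft_Cons)
    then show "is_leaf ?T ([] @ [x]) \<and> canonical_sign ?T ([] @ [x]) = Zero"
      by (simp add: canonical_sign_def)
  qed
  then have "body ?T (canonical_sign ?T) [] \<cong>\<^sub>l nat_seg n" by (simp only: w)
  moreover have "alternating_shape ?T" by (rule alternating_shape_graft) (use sh leaf in auto)
  moreover have "\<not> is_leaf ?T []" using assms by (auto simp: is_leaf_def)
  ultimately show ?thesis unfolding tree_order_def by blast
qed

text \<open>This is \<open>\<omega> \<times> f 0 + \<omega>\<^sup>* \<times> f 1 + \<dots>\<close>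
  with \<open>n\<close> pairs of summands.\<close>

definition blocks :: "nat \<Rightarrow> (nat \<Rightarrow> 'a rel) \<Rightarrow> (nat \<times> nat \<times> 'a) rel" where
  "blocks n f = lo_sum (nat_seg (2 * n)) (\<lambda>x. lo_prod (omega_sign (alt_sign x)) (f x))"

text \<open>Trees for the factors are grafted below a new root. Their roots become inner nodes
  \<open>[x]\<close>, whose canonical sign supplies the factor \<open>\<omega>\<close> or
  \<open>\<omega>\<^sup>*\<close>.\<close>

lemma tree_order_blocks:
  assumes f: "\<And>x. x < 2 * n \<Longrightarrow> tree_order (f x)" and "n \<noteq> 0"
  shows "tree_order (blocks n f)"
proof -
  have "\<forall>x\<in>{..<2 * n}. \<exists>T. alternating_shape T \<and> \<not> is_leaf T [] \<and> body T (canonical_sign T) [] \<cong>\<^sub>l f x"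
  proof
    fix x assume "x \<in> {..<2 * n}"
    then show "\<exists>T. alternating_shape T \<and> \<not> is_leaf T [] \<and> body T (canonical_sign T) [] \<cong>\<^sub>l f x"
      using f[of x] unfolding tree_order_def by blast
  qed
  from bchoice[OF this] obtain Ts where Ts: "\<And>x. x < 2 * n \<Longrightarrow> alternating_shape (Ts x)"
     "\<And>x. x < 2 * n \<Longrightarrow> \<not> is_leaf (Ts x) []"
     "\<And>x. x < 2 * n \<Longrightarrow> body (Ts x) (canonical_sign (Ts x)) [] \<cong>\<^sub>l f x"
    by auto
  let ?T = "graft (2 * n) Ts"
  have tree: "is_tree (Ts x)" if "x < 2 * n" for x
    using Ts(1)[OF that] by (simp add: alternating_shape_def)
  have w: "width ?T [] = 2 * n" by (rule width_graft_Nil) (rule tree)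
  have fin: "finite ?T" using is_tree_graft[OF tree] by (auto simp: is_tree_def)
  have b: "body ?T (canonical_sign ?T) [x] = body (Ts x) (canonical_sign (Ts x)) []" if "x < 2 * n" for x
  proof -
    have "body ?T (canonical_sign ?T) [x] = body (Ts x) (\<lambda>\<tau>. canonical_sign ?T (x # \<tau>)) []"
      by (simp add: body_child[OF fin] child_graft[OF that])
    also have "\<dots> = body (Ts x) (canonical_sign (Ts x)) []"
      using tree[OF that]
      by (intro body_root_cong) (simp_all add: is_tree_def canonical_sign_def is_leaf_graft_Cons[OF that])
    finally show ?thesis .
  qed
  have "body ?T (canonical_sign ?T) [] \<cong>\<^sub>l
    lo_sum (nat_seg (width ?T [])) (\<lambda>x. lo_prod (omega_sign (alt_sign x)) (body ?T (canonical_sign ?T) ([] @ [x])))"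
    by (rule body_blocks[OF fin])
      (use Ts(2) in \<open>auto simp: w root_in_tree tree is_leaf_graft_Cons canonical_sign_def\<close>)
  also have "\<dots> \<cong>\<^sub>l lo_sum (nat_seg (2 * n)) (\<lambda>x. lo_prod (omega_sign (alt_sign x)) (f x))"
    unfolding w
    by (intro lo_sum_cong lo_prod_cong Linear_order_lo_prod Linear_order_omega_sign Linear_order_body)
      (use Ts(3) in \<open>auto simp: b Field_nat_seg\<close>)
  finally have "body ?T (canonical_sign ?T) [] \<cong>\<^sub>l blocks n f" by (simp only: blocks_def)
  moreover have "alternating_shape ?T"
    by (rule alternating_shape_graft) (use Ts in auto)
  moreover have "\<not> is_leaf ?T []"
    using \<open>n \<noteq> 0\<close> leaf_iff_width[OF fin Nil_in_graft] w by simp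
  ultimately show ?thesis unfolding tree_order_def by blast
qed

section \<open>Absorption of finite orders\<close>

definition absorbing :: "'a rel \<Rightarrow> bool" where
  "absorbing r \<longleftrightarrow> lo_plus (nat_seg 1) r \<cong>\<^sub>l r \<and> lo_plus r (nat_seg 1) \<cong>\<^sub>l r"

lemma absorbing_iso:
  assumes "absorbing r" "r \<cong>\<^sub>l s" shows "absorbing s"
proof -
  have "lo_plus (nat_seg 1) s \<cong>\<^sub>l lo_plus (nat_seg 1) r"
    by (rule lo_plus_cong[OF lo_iso_refl lo_iso_sym[OF assms(2)]])
  also have "\<dots> \<cong>\<^sub>l r" using assms(1) by (simp add: absorbing_def)
  also note assms(2)
  finally have *: "lo_plus (nat_seg 1) s \<cong>\<^sub>l s" .
  have "lo_plus s (nat_seg 1) \<cong>\<^sub>l lo_plus r (nat_seg 1)"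
    by (rule lo_plus_cong[OF lo_iso_sym[OF assms(2)] lo_iso_refl])
  also have "\<dots> \<cong>\<^sub>l r" using assms(1) by (simp add: absorbing_def)
  also note assms(2)
  finally show ?thesis using * by (simp add: absorbing_def)
qed

text \<open>Associativity passes absorption from the first summand to the whole sum. The sum is
  given up to isomorphism, so that products with one copy split off are covered too.\<close>

lemma absorb_left:
  assumes "lo_plus s r \<cong>\<^sub>l s'" "lo_plus (nat_seg 1) s \<cong>\<^sub>l s"
  shows "lo_plus (nat_seg 1) s' \<cong>\<^sub>l s'"
proof -
  have "lo_plus (nat_seg 1) s' \<cong>\<^sub>l lo_plus (nat_seg 1) (lo_plus s r)"
    by (rule lo_plus_cong[OF lo_iso_refl lo_iso_sym[OF assms(1)]])
  also have "\<dots> \<cong>\<^sub>l lo_plus (lo_plus (nat_seg 1) s) r" by (rule lo_iso_sym[OF lo_plus_assoc])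
  also have "\<dots> \<cong>\<^sub>l lo_plus s r" by (rule lo_plus_cong[OF assms(2) lo_iso_refl])
  also note assms(1)
  finally show ?thesis .
qed

lemma absorb_right:
  assumes "lo_plus r s \<cong>\<^sub>l s'" "lo_plus s (nat_seg 1) \<cong>\<^sub>l s"
  shows "lo_plus s' (nat_seg 1) \<cong>\<^sub>l s'"
proof -
  have "lo_plus s' (nat_seg 1) \<cong>\<^sub>l lo_plus (lo_plus r s) (nat_seg 1)"
    by (rule lo_plus_cong[OF lo_iso_sym[OF assms(1)] lo_iso_refl])
  also have "\<dots> \<cong>\<^sub>l lo_plus r (lo_plus s (nat_seg 1))" by (rule lo_plus_assoc)
  also have "\<dots> \<cong>\<^sub>l lo_plus r s" by (rule lo_plus_cong[OF lo_iso_refl assms(2)])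
  also note assms(1)
  finally show ?thesis .
qed

lemma absorbing_nat_seg:
  assumes "absorbing r"
  shows "lo_plus (nat_seg n) r \<cong>\<^sub>l r" "lo_plus r (nat_seg n) \<cong>\<^sub>l r"
proof -
  have z: "nat_seg 0 = {}" by (simp add: nat_seg_def)
  show "lo_plus (nat_seg n) r \<cong>\<^sub>l r"
  proof (induction n)
    case 0 show ?case unfolding z by (rule lo_plus_empty_left)
  next
    case (Suc n)
    have "lo_plus (nat_seg (n + 1)) r \<cong>\<^sub>l lo_plus (lo_plus (nat_seg n) (nat_seg 1)) r"
      by (rule lo_plus_cong[OF nat_seg_add lo_iso_refl])
    also have "\<dots> \<cong>\<^sub>l lo_plus (nat_seg n) (lo_plus (nat_seg 1) r)" by (rule lo_plus_assoc)
    also have "\<dots> \<cong>\<^sub>l lo_plus (nat_seg n) r"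
      by (intro lo_plus_cong lo_iso_refl) (use assms in \<open>simp_all add: absorbing_def\<close>)
    also note Suc
    finally show ?case by simp
  qed
  show "lo_plus r (nat_seg n) \<cong>\<^sub>l r"
  proof (induction n)
    case 0 show ?case unfolding z by (rule lo_plus_empty_right)
  next
    case (Suc n)
    \<comment> \<open>Split as \<open>1 + n\<close> here and as \<open>n + 1\<close> in the first
      part, so that the single point is adjacent to \<open>r\<close>.\<close>
    have "lo_plus r (nat_seg (1 + n)) \<cong>\<^sub>l lo_plus r (lo_plus (nat_seg 1) (nat_seg n))"
      by (rule lo_plus_cong[OF lo_iso_refl nat_seg_add])
    also have "\<dots> \<cong>\<^sub>l lo_plus (lo_plus r (nat_seg 1)) (nat_seg n)" by (rule lo_iso_sym[OF lo_plus_assoc])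
    also have "\<dots> \<cong>\<^sub>l lo_plus r (nat_seg n)"
      by (intro lo_plus_cong lo_iso_refl) (use assms in \<open>simp_all add: absorbing_def\<close>)
    also note Suc
    finally show ?case by simp
  qed
qed

text \<open>
  The absorption property is carried along because a tree node cannot have both leaves and proper
  subtrees as children: a finite summand next to infinite blocks has to disappear.
\<close>

definition normal :: "'a rel \<Rightarrow> bool" where
  "normal r \<longleftrightarrow> (\<exists>n. n \<noteq> 0 \<and> nat_seg n \<cong>\<^sub>l r) \<or>
     (\<exists>n (f :: nat \<Rightarrow> nat rel). n \<noteq> 0 \<and> (\<forall>x<2 * n. tree_order (f x)) \<and> blocks n f \<cong>\<^sub>l r \<and> absorbing r)"

lemma normal_cases:
  assumes "normal r"
  obtains n where "n \<noteq> 0" "nat_seg n \<cong>\<^sub>l r"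
  | n and f :: "nat \<Rightarrow> nat rel" where "n \<noteq> 0" "\<And>x. x < 2 * n \<Longrightarrow> tree_order (f x)"
      "blocks n f \<cong>\<^sub>l r" "absorbing r"
  using assms unfolding normal_def by blast

lemma normal_finite: "n \<noteq> 0 \<Longrightarrow> nat_seg n \<cong>\<^sub>l r \<Longrightarrow> normal r"
  unfolding normal_def by blast

lemma normal_blocks:
  fixes f :: "nat \<Rightarrow> nat rel"
  shows "n \<noteq> 0 \<Longrightarrow> (\<And>x. x < 2 * n \<Longrightarrow> tree_order (f x)) \<Longrightarrow> blocks n f \<cong>\<^sub>l r \<Longrightarrow> absorbing r \<Longrightarrow> normal r"
  unfolding normal_def by blast

lemma normal_iso:
  assumes "normal r" "r \<cong>\<^sub>l s" shows "normal s"
  using assms(1)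
proof (cases rule: normal_cases)
  case (1 n)
  show ?thesis by (rule normal_finite[OF 1(1) lo_iso_trans[OF 1(2) assms(2)]])
next
  case (2 n f)
  show ?thesis
    by (rule normal_blocks[OF 2(1,2) lo_iso_trans[OF 2(3) assms(2)] absorbing_iso[OF 2(4) assms(2)]])
qed

lemma normal_tree_order:
  assumes "normal r" shows "tree_order r"
  using assms
proof (cases rule: normal_cases)
  case (1 n)
  then show ?thesis using tree_order_nat_seg tree_order_iso by blast
next
  case (2 n f)
  show ?thesis by (rule tree_order_iso[OF tree_order_blocks[OF 2(2,1)] 2(3)])
qed

section \<open>Closure of normal forms under sums and blocks\<close>

text \<open>The second family is shifted by the even number \<open>2 * m\<close>, so its signs are
  unchanged.\<close>

lemma blocks_append:
  assumes f: "\<And>x. x < 2 * m \<Longrightarrow> Linear_order (f x)" and g: "\<And>x. x < 2 * n \<Longrightarrow> Linear_order (g x)"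
  shows "blocks (m + n) (\<lambda>x. if x < 2 * m then f x else g (x - 2 * m)) \<cong>\<^sub>l lo_plus (blocks m f) (blocks n g)"
proof -
  let ?f = "\<lambda>x. lo_prod (omega_sign (alt_sign x)) (f x)" and ?g = "\<lambda>x. lo_prod (omega_sign (alt_sign x)) (g x)"
  show ?thesis
    unfolding blocks_def distrib_left
  proof (rule eq_lo_iso_trans)
    show "lo_sum (nat_seg (2 * m + 2 * n)) (\<lambda>x. lo_prod (omega_sign (alt_sign x)) (if x < 2 * m then f x else g (x - 2 * m)))
        = lo_sum (nat_seg (2 * m + 2 * n)) (\<lambda>x. if x < 2 * m then ?f x else ?g (x - 2 * m))"
      by (rule lo_sum_eq_cong) (simp add: alt_sign_def)
    show "lo_sum (nat_seg (2 * m + 2 * n)) (\<lambda>x. if x < 2 * m then ?f x else ?g (x - 2 * m)) \<cong>\<^sub>l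
        lo_plus (lo_sum (nat_seg (2 * m)) ?f) (lo_sum (nat_seg (2 * n)) ?g)"
      by (intro lo_sum_nat_seg_add Linear_order_lo_prod Linear_order_omega_sign f g)
  qed
qed

text \<open>Two finite orders add up, a finite order next to blocks is absorbed, and two sequences
  of blocks are concatenated.\<close>

lemma normal_plus:
  assumes r: "normal r" and s: "normal s" shows "normal (lo_plus r s)"
  using r
proof (cases rule: normal_cases)
  case r: (1 m)
  from s show ?thesis
  proof (cases rule: normal_cases)
    case s: (1 n)
    have "nat_seg (m + n) \<cong>\<^sub>l lo_plus r s"
      by (rule lo_iso_trans[OF nat_seg_add lo_plus_cong[OF r(2) s(2)]])
    then show ?thesis using normal_finite r(1) by blast
  next
    case (2 n g)
    have "lo_plus r s \<cong>\<^sub>l s"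
      by (rule lo_iso_trans[OF lo_plus_cong[OF lo_iso_sym[OF r(2)] lo_iso_refl] absorbing_nat_seg(1)[OF 2(4)]])
    then show ?thesis by (rule normal_iso[OF s lo_iso_sym])
  qed
next
  case rr: (2 m f)
  from s show ?thesis
  proof (cases rule: normal_cases)
    case s: (1 n)
    have "lo_plus r s \<cong>\<^sub>l r"
      by (rule lo_iso_trans[OF lo_plus_cong[OF lo_iso_refl lo_iso_sym[OF s(2)]] absorbing_nat_seg(2)[OF rr(4)]])
    then show ?thesis by (rule normal_iso[OF r lo_iso_sym])
  next
    case ss: (2 n g)
    let ?h = "\<lambda>x. if x < 2 * m then f x else g (x - 2 * m)"
    have "blocks (m + n) ?h \<cong>\<^sub>l lo_plus (blocks m f) (blocks n g)"
      by (rule blocks_append; rule tree_order_Linear_order) (use rr ss in auto)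
    also have "\<dots> \<cong>\<^sub>l lo_plus r s" by (rule lo_plus_cong[OF rr(3) ss(3)])
    finally have *: "blocks (m + n) ?h \<cong>\<^sub>l lo_plus r s" .
    have "absorbing (lo_plus r s)"
      using rr(4) ss(4) absorb_left[OF lo_iso_refl] absorb_right[OF lo_iso_refl]
      unfolding absorbing_def by blast
    then show ?thesis
      by (intro normal_blocks[OF _ _ *]) (use rr ss in auto)
  qed
qed

text \<open>For finite \<open>r\<close> with \<open>k + 1\<close> points, rotation gives
  \<open>1 + \<omega> \<times> (k + 1) = \<omega> \<times> (1 + k)\<close>. Otherwise
  \<open>\<omega> \<times> r = r + \<omega> \<times> r\<close>, and the leading \<open>r\<close>
  absorbs the point. The \<open>\<omega>\<^sup>*\<close> half is symmetric.\<close>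

lemma absorb_omega:
  assumes "normal r"
  shows "lo_plus (nat_seg 1) (lo_prod natLeq r) \<cong>\<^sub>l lo_prod natLeq r" (is ?L)
    and "lo_plus (lo_prod (natLeq\<inverse>) r) (nat_seg 1) \<cong>\<^sub>l lo_prod (natLeq\<inverse>) r" (is ?R)
proof -
  have lin: "Linear_order r" using assms normal_tree_order tree_order_Linear_order by blast
  have "?L \<and> ?R"
    using assms
  proof (cases rule: normal_cases)
    case (1 n)
    then obtain k where k: "n = Suc k" by (cases n) auto
    let ?l = "lo_plus (nat_seg 1) (nat_seg k)" and ?r = "lo_plus (nat_seg k) (nat_seg 1)"
    have l: "?l \<cong>\<^sub>l r"
      using lo_iso_trans[OF lo_iso_sym[OF nat_seg_add[of 1 k]]] 1(2) k by simp
    have r: "?r \<cong>\<^sub>l r"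
      using lo_iso_trans[OF lo_iso_sym[OF nat_seg_add[of k 1]]] 1(2) k by simp
    have linl: "Linear_order ?l" "Linear_order ?r" by (intro Linear_order_lo_plus Linear_order_nat_seg)+
    have L: "lo_prod A ?l \<cong>\<^sub>l lo_prod A r" "lo_prod A ?r \<cong>\<^sub>l lo_prod A r" for A :: "nat rel"
      by (rule lo_prod_cong[OF l linl(1)], rule lo_prod_cong[OF r linl(2)])
    have "lo_plus (nat_seg 1) (lo_prod natLeq r) \<cong>\<^sub>l lo_plus (nat_seg 1) (lo_prod natLeq ?r)"
      by (rule lo_plus_cong[OF lo_iso_refl lo_iso_sym[OF L(2)]])
    also have "\<dots> \<cong>\<^sub>l lo_prod natLeq ?l"
      by (rule lo_iso_sym[OF omega_rotate[OF Linear_order_nat_seg Linear_order_nat_seg]])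
    also note L(1)
    finally have ?L .
    have "lo_plus (lo_prod (natLeq\<inverse>) r) (nat_seg 1) \<cong>\<^sub>l lo_plus (lo_prod (natLeq\<inverse>) ?l) (nat_seg 1)"
      by (rule lo_plus_cong[OF lo_iso_sym[OF L(1)] lo_iso_refl])
    also have "\<dots> \<cong>\<^sub>l lo_prod (natLeq\<inverse>) ?r"
      by (rule lo_iso_sym[OF omega_star_rotate[OF Linear_order_nat_seg Linear_order_nat_seg]])
    also note L(2)
    finally show ?thesis using \<open>?L\<close> by blast
  next
    case (2 n f)
    \<comment> \<open>Rotation with an empty summand unrolls one copy of \<open>r\<close> from the
      product.\<close>
    define e :: "nat rel" where "e = {}"
    have line: "Linear_order e" unfolding e_def by (rule Linear_order_empty)
    let ?l = "lo_plus e r" and ?r = "lo_plus r e"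
    have l: "?l \<cong>\<^sub>l r" unfolding e_def by (rule lo_plus_empty_left)
    have r: "?r \<cong>\<^sub>l r" unfolding e_def by (rule lo_plus_empty_right)
    have linl: "Linear_order ?l" "Linear_order ?r" by (intro Linear_order_lo_plus lin line)+
    have L: "lo_prod A ?l \<cong>\<^sub>l lo_prod A r" "lo_prod A ?r \<cong>\<^sub>l lo_prod A r" for A :: "nat rel"
      by (rule lo_prod_cong[OF l linl(1)], rule lo_prod_cong[OF r linl(2)])
    have "lo_plus r (lo_prod natLeq r) \<cong>\<^sub>l lo_plus r (lo_prod natLeq ?l)"
      by (rule lo_plus_cong[OF lo_iso_refl lo_iso_sym[OF L(1)]])
    also have "\<dots> \<cong>\<^sub>l lo_prod natLeq ?r" by (rule lo_iso_sym[OF omega_rotate[OF lin line]])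
    also note L(2)
    finally have ?L using absorb_left 2(4) unfolding absorbing_def by blast
    have "lo_plus (lo_prod (natLeq\<inverse>) r) r \<cong>\<^sub>l lo_plus (lo_prod (natLeq\<inverse>) ?r) r"
      by (rule lo_plus_cong[OF lo_iso_sym[OF L(2)] lo_iso_refl])
    also have "\<dots> \<cong>\<^sub>l lo_prod (natLeq\<inverse>) ?l" by (rule lo_iso_sym[OF omega_star_rotate[OF line lin]])
    also note L(1)
    finally have ?R using absorb_right 2(4) unfolding absorbing_def by blast
    then show ?thesis using \<open>?L\<close> by blast
  qed
  then show ?L ?R by blast+
qed

text \<open>A point on the left is absorbed by the \<open>\<omega>\<close> part, a point on the
  right by the \<open>\<omega>\<^sup>*\<close> part, so a single pair already absorbs on both
  sides.\<close>

lemma normal_block: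
  fixes r s :: "nat rel"
  assumes r: "normal r" and s: "normal s"
  shows "normal (lo_plus (lo_prod natLeq r) (lo_prod (natLeq\<inverse>) s))" (is "normal ?b")
proof -
  let ?f = "\<lambda>x::nat. if x = 0 then r else s"
  have t: "tree_order r" "tree_order s" using r s normal_tree_order by auto
  have lin: "Linear_order r" "Linear_order s" using t tree_order_Linear_order by auto
  have "blocks 1 ?f \<cong>\<^sub>l lo_plus (lo_prod (omega_sign (alt_sign 0)) (?f 0)) (lo_prod (omega_sign (alt_sign (Suc 0))) (?f (Suc 0)))"
    unfolding blocks_def mult_1_right
    by (rule lo_sum_two; rule Linear_order_lo_prod[OF Linear_order_omega_sign]) (use lin in auto)
  then have *: "blocks 1 ?f \<cong>\<^sub>l ?b" by (simp add: alt_sign_def)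
  have "absorbing ?b"
    unfolding absorbing_def
    using absorb_left[OF lo_iso_refl absorb_omega(1)[OF r]] absorb_right[OF lo_iso_refl absorb_omega(2)[OF s]] by blast
  then show ?thesis by (intro normal_blocks[OF _ _ *]) (use t in auto)
qed

lemma alternating_order_nat_normal: "alternating_order_nat r \<Longrightarrow> normal r"
proof (induction rule: alternating_order_nat.induct)
  case (alternating_order_nat_one a)
  have "nat_seg 1 = {(0, 0)}" by (auto simp: nat_seg_def)
  then have "nat_seg 1 \<cong>\<^sub>l {(a, a)}" by (simp add: lo_iso_singleton)
  then show ?case using normal_finite[of 1] by simp
next
  case (alternating_order_nat_plus r s t)
  show ?case by (rule normal_iso[OF normal_plus[OF alternating_order_nat_plus.IH] alternating_order_nat_plus.hyps(3)])
next
  case (alternating_order_nat_block r s t)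
  show ?case by (rule normal_iso[OF normal_block[OF alternating_order_nat_block.IH] alternating_order_nat_block.hyps(3)])
qed

lemma alternating_order_tree_order: "alternating_order r \<Longrightarrow> tree_order r"
  unfolding alternating_order_def using alternating_order_nat_normal normal_tree_order tree_order_iso by blast

theorem theorem7p2:
  fixes L :: "'a rel"
  assumes "finitely_presented L"
  shows "(L = {} \<or> lo_bounded L) \<and> lo_discrete L \<longleftrightarrow>
         (\<exists>T s. signed_tree3 T s \<and> alternating T s \<and> LIN T s \<cong>\<^sub>l L)"
proof
  assume L: "(L = {} \<or> lo_bounded L) \<and> lo_discrete L"
  show "\<exists>T s. signed_tree3 T s \<and> alternating T s \<and> LIN T s \<cong>\<^sub>l L"
  proof (cases "L = {}")
    \<comment> \<open>The members of the class are nonempty, so the empty order is realised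
      separately, by the one-node tree.\<close>
    case True
    have w: "width {[]} [] = 0" and leaf: "is_leaf {[]} []" by (simp_all add: width_def is_leaf_def)
    have "signed_tree3 {[]} (\<lambda>_. Zero)" "alternating {[]} (\<lambda>_. Zero)"
      using w leaf by (simp_all add: signed_tree3_def is_tree_def standard_labelling_def alternating_def)
    moreover have "LIN {[]} (\<lambda>_. Zero) \<cong>\<^sub>l L" using True by (simp add: LIN_def lo_iso_empty)
    ultimately show ?thesis by blast
  next
    case False
    then have "alternating_order L" using L bounded_discrete_imp_alternating_order[OF assms] by blast
    then show ?thesis by (intro tree_order_LIN alternating_order_tree_order)
  qed
next
  assume "\<exists>T s. signed_tree3 T s \<and> alternating T s \<and> LIN T s \<cong>\<^sub>l L"
  then obtain T s where T: "signed_tree3 T s" "alternating T s" "LIN T s \<cong>\<^sub>l L" by blast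
  from LIN_empty_or_alternating_order[OF T(1,2)] show "(L = {} \<or> lo_bounded L) \<and> lo_discrete L"
  proof
    assume "LIN T s = {}"
    then have "L = {}" using lo_iso_empty_iff[OF T(3)] by simp
    then show ?thesis by (simp add: lo_discrete_def)
  next
    assume "alternating_order (LIN T s)"
    then have "alternating_order L" using T(3) by (rule alternating_order_iso)
    then show ?thesis using alternating_order_bounded_discrete[of L] by (simp add: lo_bounded_iff)
  qed
qed

end
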